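(* Let $E=\begin{bmatrix} I_p\\ 0\end{bmatrix}\in\mathrm{St}(n,p)$, and let $$ \psi_E:\ \mathrm{St}(n,p)\supset\mathcal{B}\to T_E\mathrm{St}(n,p)\cong\mathrm{skew}(p)\times\mathbb{R}^{(n-p)\times p},\qquad U=\begin{bmatrix} U_1\\ U_2\end{bmatrix}\mapsto \begin{bmatrix}\log_m\!\left(U_1(U_1^TU_1)^{-\frac12}\right)\\ U_2(U_1^TU_1)^{-\frac12}\end{bmatrix}=:\begin{bmatrix} A\\ B\end{bmatrix} $$ be the coordinate chart defined on a suitable (relative) open, path-connected neighborhood $\mathcal{B}\subset\mathrm{St}(n,p)$ around $E$. The map $\psi_E$ is invertible; the inverse map $\varphi_E=\psi_E^{-1}$ is a local parameterization and is given by $$ \varphi_E:\ \mathrm{skew}(p)\times\mathbb{R}^{(n-p)\times p}\to \mathrm{St}(n,p),\qquad \begin{bmatrix} A\\ B\end{bmatrix}\mapsto \begin{bmatrix}\exp_m(A)\\ B\end{bmatrix}(I_p+B^TB)^{-\frac12}. $$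
   Context: $\mathrm{St}(n,p)=\{U\in\mathbb{R}^{n\times p}\mid U^TU=I_p\}$ is the Stiefel manifold, $I_p$ is the $p\times p$ identity matrix, and $\mathrm{skew}(p)$ is the space of real skew-symmetric $p\times p$ matrices. A matrix $U\in\mathrm{St}(n,p)$ is split into blocks $U=\begin{bmatrix} U_1\\ U_2\end{bmatrix}$ with $U_1\in\mathbb{R}^{p\times p}$ (invertible for $U\in\mathcal{B}$) and $U_2\in\mathbb{R}^{(n-p)\times p}$. Pairs $(A,B)\in\mathrm{skew}(p)\times\mathbb{R}^{(n-p)\times p}$ are written as stacked matrices $\begin{bmatrix} A\\ B\end{bmatrix}$; these are the elements of the tangent space $T_E\mathrm{St}(n,p)$. $(\cdot)^{-\frac12}$ denotes the inverse of the symmetric positive definite square root of a symmetric positive definite matrix. $\exp_m$ is the matrix exponential and $\log_m$ is the matrix logarithm. *)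

theory Defs
  imports "HOL-Analysis.Analysis"
begin

subsection \<open>Matrix functions\<close>

definition matrix_power :: "real^'p^'p \<Rightarrow> nat \<Rightarrow> real^'p^'p" where
  "matrix_power A k = (((**) A) ^^ k) (mat 1)"

definition exp_m :: "real^'p^'p \<Rightarrow> real^'p^'p" where
  "exp_m A = (\<Sum>k. (1 / fact k) *\<^sub>R matrix_power A k)"

definition complex_eigenvalue :: "real^'p^'p \<Rightarrow> complex \<Rightarrow> bool" where
  "complex_eigenvalue A z \<longleftrightarrow> (\<exists>v. v \<noteq> 0 \<and> map_matrix complex_of_real A *v v = z *s v)"

text \<open>The principal matrix logarithm. It exists and is unique for the matrices without eigenvalues
  on the closed negative real axis; for other matrices the value is irrelevant.\<close>

definition log_m :: "real^'p^'p \<Rightarrow> real^'p^'p" where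
  "log_m M = (THE X. exp_m X = M \<and> (\<forall>z. complex_eigenvalue X z \<longrightarrow> - pi < Im z \<and> Im z < pi))"

definition log_m_defined :: "real^'p^'p \<Rightarrow> bool" where
  "log_m_defined M \<longleftrightarrow> (\<forall>z. complex_eigenvalue M z \<longrightarrow> z \<notin> \<real>\<^sub>\<le>\<^sub>0)"

definition spd :: "real^'p^'p \<Rightarrow> bool" where
  "spd S \<longleftrightarrow> transpose S = S \<and> (\<forall>x. x \<noteq> 0 \<longrightarrow> x \<bullet> (S *v x) > 0)"

definition sqrt_m :: "real^'p^'p \<Rightarrow> real^'p^'p" where
  "sqrt_m S = (THE R. spd R \<and> R ** R = S)"

definition inv_sqrt_m :: "real^'p^'p \<Rightarrow> real^'p^'p" where
  "inv_sqrt_m S = matrix_inv (sqrt_m S)"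

subsection \<open>The Stiefel manifold and the block decomposition\<close>

definition Stiefel :: "(real^'p^'n) set" where
  "Stiefel = {U. transpose U ** U = mat 1}"

definition skew :: "(real^'p^'p) set" where
  "skew = {A. transpose A = - A}"

text \<open>The index types \<^typ>\<open>'n\<close> and \<^typ>\<open>'p\<close> stand for $\{1,\dots,n\}$ and $\{1,\dots,p\}$. An injection
  \<open>\<iota>\<close> from \<^typ>\<open>'p\<close> to \<^typ>\<open>'n\<close> names the first \<open>p\<close> rows, in order; so every \<open>p \<le> n\<close> is covered,
  including \<open>p = n\<close>, where the lower block is empty. An \<open>(n-p)\<times>p\<close> matrix is represented as a matrix of
  type \<^typ>\<open>real^'p^'n\<close> whose rows with index in \<^term>\<open>range \<iota>\<close> are zero; this does not change \<open>B\<^sup>TB\<close>.\<close>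

definition upper :: "('p \<Rightarrow> 'n) \<Rightarrow> real^'p^'n \<Rightarrow> real^'p^'p" where
  "upper \<iota> U = (\<chi> i. U $ \<iota> i)"

definition lower :: "('p \<Rightarrow> 'n) \<Rightarrow> real^'p^'n \<Rightarrow> real^'p^'n" where
  "lower \<iota> U = (\<chi> k. if k \<in> range \<iota> then 0 else U $ k)"

definition lower_blocks :: "('p \<Rightarrow> 'n) \<Rightarrow> (real^'p^'n) set" where
  "lower_blocks \<iota> = {B. \<forall>i. B $ \<iota> i = 0}"

definition stack :: "('p \<Rightarrow> 'n) \<Rightarrow> real^'p^'p \<Rightarrow> real^'p^'n \<Rightarrow> real^'p^'n" where
  "stack \<iota> A B = (\<chi> k. if k \<in> range \<iota> then A $ (inv \<iota> k) else B $ k)"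

definition base_point :: "('p \<Rightarrow> 'n) \<Rightarrow> real^'p^'n" where
  "base_point \<iota> = stack \<iota> (mat 1) 0"

definition polar_factor :: "real^'p^'p \<Rightarrow> real^'p^'p" where
  "polar_factor M = M ** inv_sqrt_m (transpose M ** M)"

definition psi :: "('p \<Rightarrow> 'n) \<Rightarrow> real^'p^'n \<Rightarrow> (real^'p^'p) \<times> (real^'p^'n)" where
  "psi \<iota> U = (log_m (polar_factor (upper \<iota> U)),
              lower \<iota> U ** inv_sqrt_m (transpose (upper \<iota> U) ** upper \<iota> U))"

definition phi :: "('p \<Rightarrow> 'n) \<Rightarrow> (real^'p^'p) \<times> (real^'p^'n) \<Rightarrow> real^'p^'n" where
  "phi \<iota> = (\<lambda>(A, B). stack \<iota> (exp_m A) B ** inv_sqrt_m (mat 1 + transpose B ** B))"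

text \<open>The neighbourhoods of the base point on which the formula for \<^term>\<open>psi\<close> makes sense.\<close>

definition chart_domain :: "('p \<Rightarrow> 'n) \<Rightarrow> (real^'p^'n) set \<Rightarrow> bool" where
  "chart_domain \<iota> D \<longleftrightarrow>
     openin (top_of_set Stiefel) D \<and> path_connected D \<and> base_point \<iota> \<in> D \<and>
     (\<forall>U\<in>D. invertible (upper \<iota> U) \<and> log_m_defined (polar_factor (upper \<iota> U)))"

subsection \<open>Smooth maps between subsets of Euclidean spaces\<close>

text \<open>\<open>k\<close>-fold continuous differentiability on an open set, through iterated directional
  derivatives (adequate in finite dimension).\<close>

primrec Ck_on :: "nat \<Rightarrow> 'a::euclidean_space set \<Rightarrow> ('a \<Rightarrow> 'b::euclidean_space) \<Rightarrow> bool" where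
  "Ck_on 0 W f \<longleftrightarrow> continuous_on W f"
| "Ck_on (Suc k) W f \<longleftrightarrow> (\<forall>x\<in>W. f differentiable (at x)) \<and>
     (\<forall>v. Ck_on k W (\<lambda>x. frechet_derivative f (at x) v))"

text \<open>On an arbitrary subset, a map is smooth if it extends smoothly to an open neighbourhood of each
  point; for embedded submanifolds and relatively open subsets of subspaces this is the usual notion.\<close>

definition smooth_map :: "'a::euclidean_space set \<Rightarrow> ('a \<Rightarrow> 'b::euclidean_space) \<Rightarrow> bool" where
  "smooth_map S f \<longleftrightarrow>
     (\<forall>x\<in>S. \<exists>W g. open W \<and> x \<in> W \<and> (\<forall>k. Ck_on k W g) \<and> (\<forall>y\<in>S \<inter> W. g y = f y))"

definition diffeomorphism ::
    "'a::euclidean_space set \<Rightarrow> 'b::euclidean_space set \<Rightarrow> ('a \<Rightarrow> 'b) \<Rightarrow> ('b \<Rightarrow> 'a) \<Rightarrow> bool" where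
  "diffeomorphism S T f g \<longleftrightarrow> homeomorphism S T f g \<and> smooth_map S f \<and> smooth_map T g"

end

theory Submission
  imports Defs "HOL-Computational_Algebra.Fundamental_Theorem_Algebra"
begin

text \<open>The chart and its inverse are explicit, so invertibility is a computation with the two blocks once
three matrix functions are under control: the exponential, the principal logarithm and the inverse
square root. All three have to be smooth on open sets of \<^emph>\<open>all\<close> square matrices, because smoothness
on the Stiefel manifold means local extension to open sets of the ambient space.

The logarithm carries the proof. For a matrix \<open>M\<close> put
\<open>log_int M = \<integral>\<^sub>0\<^sup>1 (M - I) (I + t (M - I))\<^bsup>-1\<^esup> dt\<close>, defined when the segment from \<open>I\<close> to \<open>M\<close> contains no
singular matrix; this set, \<open>log_domain\<close>, is open by compactness of the segment, and it consists exactly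
of the matrices without eigenvalues on the closed negative real axis (\<open>log_m_defined_iff\<close>). Being an
integral of a smooth function over a compact interval, \<open>log_int\<close> is smooth. Differentiating along the
segment gives \<open>exp (log_int M) = M\<close> (\<open>exp_m_log_int\<close>). Conversely \<open>log_int (exp X) = X\<close> as long as the
curve \<open>exp (s X)\<close>, \<open>0 \<le> s \<le> 1\<close>, stays in \<open>log_domain\<close> (\<open>log_int_exp_m\<close>); the set \<open>exp_domain\<close> of
these \<open>X\<close> is again open. Simultaneous eigenvectors of commuting matrices connect this with the
spectral strip \<open>\<bar>Im z\<bar> < pi\<close> in the definition of the principal logarithm, and so \<open>log_m\<close> agrees with
\<open>log_int\<close> (\<open>log_m_eq_log_int\<close>). The inverse square root of a positive definite \<open>S\<close> is then
\<open>exp (- log_int S / 2)\<close>, which extends it smoothly to \<open>log_domain\<close>.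

For the chart itself, let \<open>S = U\<^sub>1\<^sup>T U\<^sub>1\<close> and \<open>P = S\<^bsup>-1/2\<^esup>\<close>, so that \<open>P S P = I\<close>, the matrix \<open>U\<^sub>1 P\<close> is
orthogonal, and its logarithm \<open>A\<close> is skew. As \<open>U\<^sub>1\<^sup>T U\<^sub>1 + U\<^sub>2\<^sup>T U\<^sub>2 = I\<close>, the block \<open>B = U\<^sub>2 P\<close> satisfies
\<open>I + B\<^sup>T B = I + P (I - S) P = P\<^sup>2\<close>, and the factor \<open>(I + B\<^sup>T B)\<^bsup>-1/2\<^esup> = P\<^bsup>-1\<^esup>\<close> undoes the normalisation
(\<open>phi_psi\<close>). The same identity read backwards gives \<open>psi (phi (A, B)) = (A, B)\<close> for \<open>A\<close> in
\<open>exp_domain\<close> (\<open>psi_phi\<close>). Consequently \<open>psi\<close> maps a chart domain \<open>Stiefel \<inter> W\<close>, with \<open>W\<close> open, onto the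
relatively open set of those pairs with \<open>A\<close> in \<open>exp_domain\<close> that \<open>phi\<close> sends into \<open>W\<close>. The largest
candidate for a chart domain is the image under \<open>phi\<close> of a star-shaped set and hence path connected,
so that chart domains exist.\<close>

section \<open>Maps of class C^k\<close>

lemma Ck_on_cong:
  assumes "Ck_on k W f" "\<And>x. x \<in> W \<Longrightarrow> f x = g x" and W: "open W"
  shows "Ck_on k W g"
  using assms(1,2)
proof (induction k arbitrary: f g)
  case 0
  then show ?case by (metis Ck_on.simps(1) continuous_on_cong)
next
  case (Suc k)
  have "g differentiable (at x)" if "x \<in> W" for x
    using Suc.prems W that has_derivative_transform_within_open
    unfolding Ck_on.simps differentiable_def by metis
  moreover have "frechet_derivative f (at x) = frechet_derivative g (at x)" if "x \<in> W" for x
    using Suc.prems W that by (intro frechet_derivative_transform_within_open) auto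
  ultimately show ?case using Suc by (auto intro: Suc.IH)
qed

text \<open>Any explicit formula for the derivative may replace the Frechet derivative chosen by the definition;
the rules for sums, products, compositions and parametric integrals rest on this.\<close>

lemma Ck_on_SucI:
  assumes "\<And>x. x \<in> W \<Longrightarrow> (f has_derivative f' x) (at x)"
    and "\<And>v. Ck_on k W (\<lambda>x. f' x v)" and "open W"
  shows "Ck_on (Suc k) W f"
proof -
  have "f' x = frechet_derivative f (at x)" if "x \<in> W" for x
    by (intro frechet_derivative_at assms that)
  then show ?thesis
    using assms Ck_on_cong[OF assms(2)] by (auto simp: differentiable_def)
qed

lemma Ck_on_has_derivative:
  assumes "Ck_on (Suc k) W f" "x \<in> W"
  shows "(f has_derivative frechet_derivative f (at x)) (at x)"
  using assms frechet_derivative_works by auto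

lemma Ck_on_directional: "Ck_on (Suc k) W f \<Longrightarrow> Ck_on k W (\<lambda>x. frechet_derivative f (at x) v)"
  by simp

lemma Ck_on_Suc_imp: "Ck_on (Suc k) W f \<Longrightarrow> Ck_on k W f"
  by (induction k arbitrary: f)
     (auto intro!: continuous_at_imp_continuous_on differentiable_imp_continuous_within)

lemma Ck_on_imp_continuous_on: "Ck_on k W f \<Longrightarrow> continuous_on W f"
  by (induction k) (auto dest: Ck_on_Suc_imp simp del: Ck_on.simps(2))

lemma Ck_on_subset: "Ck_on k W f \<Longrightarrow> V \<subseteq> W \<Longrightarrow> Ck_on k V f"
  by (induction k arbitrary: f) (auto intro: continuous_on_subset)

lemma Ck_on_const: "open W \<Longrightarrow> Ck_on k W (\<lambda>x. c)"
  by (induction k arbitrary: c)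
     (auto intro!: Ck_on_SucI[where f' = "\<lambda>_ _. 0"] simp del: Ck_on.simps(2))

lemma Ck_on_bounded_linear:
  assumes "bounded_linear f" "open W" shows "Ck_on k W f"
proof (cases k)
  case (Suc j)
  then show ?thesis using assms
    by (auto intro!: Ck_on_SucI[where f' = "\<lambda>_. f"] Ck_on_const bounded_linear_imp_has_derivative
        simp del: Ck_on.simps(2))
qed (use assms in \<open>simp add: linear_continuous_on\<close>)

lemma Ck_on_add:
  assumes "Ck_on k W f" "Ck_on k W g" "open W" shows "Ck_on k W (\<lambda>x. f x + g x)"
  using assms
proof (induction k arbitrary: f g)
  case (Suc k)
  note D = Ck_on_has_derivative[OF Suc.prems(1)] Ck_on_has_derivative[OF Suc.prems(2)]
  show ?case
    by (rule Ck_on_SucI[where f' = "\<lambda>x v. frechet_derivative f (at x) v + frechet_derivative g (at x) v"])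
       (use Suc in \<open>auto intro!: has_derivative_add D\<close>)
qed (auto intro: continuous_on_add)

lemma Ck_on_sum:
  assumes "\<And>i. i \<in> I \<Longrightarrow> Ck_on k W (f i)" "open W" shows "Ck_on k W (\<lambda>x. \<Sum>i\<in>I. f i x)"
  using assms by (induction I rule: infinite_finite_induct) (auto intro: Ck_on_add Ck_on_const)

lemma Ck_on_bilinear:
  assumes "bounded_bilinear b" "Ck_on k W f" "Ck_on k W g" "open W"
  shows "Ck_on k W (\<lambda>x. b (f x) (g x))"
  using assms(2-4)
proof (induction k arbitrary: f g)
  case 0
  then show ?case using bounded_bilinear.continuous_on[OF assms(1)] by auto
next
  case (Suc k)
  note D = Ck_on_has_derivative[OF Suc.prems(1)] Ck_on_has_derivative[OF Suc.prems(2)]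
  show ?case
  proof (rule Ck_on_SucI)
    fix x assume "x \<in> W"
    then show "((\<lambda>x. b (f x) (g x)) has_derivative
      (\<lambda>v. b (f x) (frechet_derivative g (at x) v) + b (frechet_derivative f (at x) v) (g x))) (at x)"
      by (intro bounded_bilinear.FDERIV[OF assms(1)] D)
  next
    fix v
    show "Ck_on k W (\<lambda>x. b (f x) (frechet_derivative g (at x) v) + b (frechet_derivative f (at x) v) (g x))"
      by (rule Ck_on_add[OF
            Suc.IH[OF Ck_on_Suc_imp[OF Suc.prems(1)] Ck_on_directional[OF Suc.prems(2)] Suc.prems(3)]
            Suc.IH[OF Ck_on_directional[OF Suc.prems(1)] Ck_on_Suc_imp[OF Suc.prems(2)] Suc.prems(3)]
            Suc.prems(3)])
  qed (use Suc in auto)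
qed

lemma linear_eq_sum_Basis:
  fixes h :: "'a::euclidean_space \<Rightarrow> 'b::real_vector"
  assumes "linear h" shows "h w = (\<Sum>b\<in>Basis. (w \<bullet> b) *\<^sub>R h b)"
proof -
  have "h w = h (\<Sum>b\<in>Basis. (w \<bullet> b) *\<^sub>R b)" by (simp add: euclidean_representation)
  then show ?thesis by (simp only: linear_sum[OF assms] linear_cmul[OF assms])
qed

text \<open>The class is defined through derivatives in fixed directions, whereas in the chain rule the direction
fed to the outer derivative moves with the point. Expanding that direction in the standard basis
turns the derivative into a sum of products of maps to which the induction hypothesis applies.\<close>

lemma Ck_on_compose:
  assumes "Ck_on k W f" "Ck_on k V g" "open W" "open V" "\<And>x. x \<in> W \<Longrightarrow> f x \<in> V"
  shows "Ck_on k W (\<lambda>x. g (f x))"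
  using assms(1,2)
proof (induction k arbitrary: g)
  case 0
  then have "continuous_on V g" "continuous_on W f" by simp_all
  moreover have "f ` W \<subseteq> V" using assms(5) by blast
  ultimately show ?case by (simp add: continuous_on_compose2[of V g W f])
next
  case (Suc k)
  note Df = Ck_on_has_derivative[OF Suc.prems(1)] and Dg = Ck_on_has_derivative[OF Suc.prems(2)]
  show ?case
  proof (rule Ck_on_SucI)
    fix x assume x: "x \<in> W"
    have "(\<lambda>v. \<Sum>b\<in>Basis. (frechet_derivative f (at x) v \<bullet> b) *\<^sub>R frechet_derivative g (at (f x)) b)
        = (\<lambda>v. frechet_derivative g (at (f x)) (frechet_derivative f (at x) v))"
      by (rule ext, rule linear_eq_sum_Basis[symmetric])
         (rule has_derivative_linear[OF Dg[OF assms(5)[OF x]]])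
    then show "((\<lambda>x. g (f x)) has_derivative
      (\<lambda>v. \<Sum>b\<in>Basis. (frechet_derivative f (at x) v \<bullet> b) *\<^sub>R frechet_derivative g (at (f x)) b)) (at x)"
      by (simp only: has_derivative_compose[OF Df[OF x] Dg[OF assms(5)[OF x]]])
  next
    fix v
    have "Ck_on k W (\<lambda>x. frechet_derivative g (at (f x)) b)" for b
      by (rule Suc.IH[OF Ck_on_Suc_imp[OF Suc.prems(1)] Ck_on_directional[OF Suc.prems(2)]])
    moreover have "Ck_on k W (\<lambda>x. frechet_derivative f (at x) v \<bullet> b)" for b
      by (rule Ck_on_bilinear[OF bounded_bilinear_inner Ck_on_directional[OF Suc.prems(1)]
            Ck_on_const[OF assms(3)] assms(3)])
    ultimately have "Ck_on k W (\<lambda>x.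
        (frechet_derivative f (at x) v \<bullet> b) *\<^sub>R frechet_derivative g (at (f x)) b)" for b
      by (rule Ck_on_bilinear[OF bounded_bilinear_scaleR _ _ assms(3), rotated])
    then show "Ck_on k W (\<lambda>x. \<Sum>b\<in>Basis.
        (frechet_derivative f (at x) v \<bullet> b) *\<^sub>R frechet_derivative g (at (f x)) b)"
      by (rule Ck_on_sum[OF _ assms(3)])
  qed (rule assms(3))
qed

lemma Ck_on_linear_compose:
  assumes "bounded_linear h" "Ck_on k W f" "open W" shows "Ck_on k W (\<lambda>x. h (f x))"
  by (rule Ck_on_compose[OF assms(2) Ck_on_bounded_linear[OF assms(1) open_UNIV] assms(3) open_UNIV UNIV_I])

lemma Ck_on_Pair:
  assumes "Ck_on k W f" "Ck_on k W g" "open W" shows "Ck_on k W (\<lambda>x. (f x, g x))"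
proof -
  have l: "bounded_linear (\<lambda>y. (y, 0))" "bounded_linear (\<lambda>y. (0, y))"
    by (auto intro: bounded_linear_Pair bounded_linear_ident bounded_linear_zero)
  have "Ck_on k W (\<lambda>x. (f x, 0) + (0, g x))"
    by (rule Ck_on_add[OF Ck_on_linear_compose[OF l(1) assms(1,3)] Ck_on_linear_compose[OF l(2) assms(2,3)] assms(3)])
  then show ?thesis by (simp only: add_Pair add_0 add_0_right)
qed

lemma Ck_on_vec_lambda:
  fixes f :: "'i::finite \<Rightarrow> 'a::euclidean_space \<Rightarrow> 'b::euclidean_space"
  assumes "\<And>i. Ck_on k W (f i)" "open W" shows "Ck_on k W (\<lambda>x. \<chi> i. f i x)"
proof -
  have "bounded_linear (axis i :: 'b \<Rightarrow> 'b^'i)" for i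
    unfolding linear_conv_bounded_linear[symmetric]
    by (rule linearI) (auto simp: axis_def vec_eq_iff)
  then have "Ck_on k W (\<lambda>x. \<Sum>i\<in>UNIV. axis i (f i x))"
    by (rule Ck_on_sum[OF Ck_on_linear_compose[OF _ assms] assms(2)])
  moreover have "(\<Sum>i\<in>UNIV. axis i (f i x)) = (\<chi> i. f i x)" for x
    by (simp add: vec_eq_iff axis_def sum.delta')
  ultimately show ?thesis by simp
qed

lemma Ck_on_prod:
  fixes f :: "'i \<Rightarrow> 'a::euclidean_space \<Rightarrow> real"
  assumes "\<And>i. i \<in> I \<Longrightarrow> Ck_on k W (f i)" "open W" shows "Ck_on k W (\<lambda>x. \<Prod>i\<in>I. f i x)"
  using assms
  by (induction I rule: infinite_finite_induct)
     (auto intro: Ck_on_bilinear[OF bounded_bilinear_mult] Ck_on_const)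

lemma Ck_on_inverse: "Ck_on k (- {0}) (inverse :: real \<Rightarrow> real)"
proof (induction k)
  case (Suc k)
  show ?case
  proof (rule Ck_on_SucI[where f' = "\<lambda>x v. - (inverse x * v * inverse x)"])
    fix v :: real
    have "Ck_on k (- {0}) (\<lambda>x. (inverse x * inverse x) * (- v))"
      by (intro Ck_on_bilinear[OF bounded_bilinear_mult] Ck_on_const Suc) auto
    then show "Ck_on k (- {0}) (\<lambda>x. - (inverse x * v * inverse x))"
      by (simp add: algebra_simps)
  qed (auto intro!: has_derivative_inverse')
qed (auto intro: continuous_on_inverse)

text \<open>The integrand is required to be of class C^k jointly in the integration variable and the parameter. A
directional derivative in the parameter is then a function of the same kind, of class one lower,
so that differentiation under the integral sign can be iterated by induction.\<close>

lemma Ck_on_integral: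
  fixes f :: "real \<times> 'a::euclidean_space \<Rightarrow> 'b::euclidean_space"
  assumes "Ck_on k V f" "open V" "open W" "{0..1} \<times> W \<subseteq> V"
  shows "Ck_on k W (\<lambda>x. integral {0..1} (\<lambda>t. f (t, x)))"
  using assms(1)
proof (induction k arbitrary: f)
  case 0
  have "continuous_on (W \<times> cbox 0 1) (\<lambda>(x, t). f (t, x))"
    unfolding split_beta
    by (rule continuous_on_compose2[of V f]) (use 0 assms in \<open>auto intro!: continuous_intros\<close>)
  then show ?case using integral_continuous_on_param by fastforce
next
  case (Suc k)
  define f' where "f' p v = frechet_derivative f (at p) (0, v)" for p v
  have Df: "(f has_derivative frechet_derivative f (at p)) (at p)" if "p \<in> V" for p
    by (rule Ck_on_has_derivative[OF Suc.prems that])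
  have f'_lin: "bounded_linear (f' p)" if "p \<in> V" for p
    unfolding f'_def
    by (intro bounded_linear_compose[OF has_derivative_bounded_linear[OF Df[OF that]]]
        bounded_linear_Pair bounded_linear_ident bounded_linear_zero)
  \<comment> \<open>The Leibniz rule wants the derivative as a continuous family of bounded linear maps.\<close>
  define F where "F x t = Blinfun (f' (t, x))" for x t
  have F: "F x t v = f' (t, x) v" if "(t, x) \<in> V" for t x v
    unfolding F_def by (simp add: bounded_linear_Blinfun_apply f'_lin[OF that])
  have f'_Ck: "Ck_on k V (\<lambda>p. f' p v)" for v
    using Suc.prems by (simp add: f'_def)
  have contF: "continuous_on (W \<times> cbox 0 1) (\<lambda>(x, t). F x t)"
  proof (rule continuous_on_blinfun_componentwise)
    fix i :: 'a
    have "continuous_on (W \<times> cbox 0 1) (\<lambda>(x, t). f' (t, x) i)"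
      unfolding split_beta
      by (rule continuous_on_compose2[OF Ck_on_imp_continuous_on[OF f'_Ck]])
         (use assms in \<open>auto intro!: continuous_intros\<close>)
    then show "continuous_on (W \<times> cbox 0 1) (\<lambda>p. blinfun_apply (case p of (x, t) \<Rightarrow> F x t) i)"
      by (rule continuous_on_eq) (use assms F in auto)
  qed
  have contf: "continuous_on (cbox 0 1) (\<lambda>t. f (t, x))" if "x \<in> W" for x
    by (rule continuous_on_compose2[OF Ck_on_imp_continuous_on[OF Suc.prems]])
       (use assms that in \<open>auto intro!: continuous_intros\<close>)
  show ?case
  proof (rule Ck_on_SucI)
    fix x assume x: "x \<in> W"
    then obtain e where e: "e > 0" "ball x e \<subseteq> W"
      using assms(3) open_contains_ball by blast
    have "((\<lambda>x. integral (cbox 0 1) (\<lambda>t. f (t, x))) has_derivative integral (cbox 0 1) (F x))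
        (at x within ball x e)"
    proof (rule leibniz_rule[where fx = F])
      fix y and t :: real assume yt: "y \<in> ball x e" "t \<in> cbox 0 1"
      then have "y \<in> W" using e by blast
      then have V: "(t, y) \<in> V" using yt assms(4) by auto
      have "((\<lambda>y. f (t, y)) has_derivative f' (t, y)) (at y)"
        unfolding f'_def
        by (rule has_derivative_compose[of "Pair t" _ y UNIV f, OF _ Df[OF V]])
           (auto intro!: derivative_eq_intros)
      then show "((\<lambda>y. f (t, y)) has_derivative blinfun_apply (F y t)) (at y within ball x e)"
        using F[OF V] by (metis (no_types, lifting) ext has_derivative_at_withinI)
    qed (use e contF contf in \<open>auto intro!: integrable_continuous_interval elim: continuous_on_subset\<close>)
    then have "((\<lambda>x. integral {0..1} (\<lambda>t. f (t, x))) has_derivative integral (cbox 0 1) (F x)) (at x)"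
      using at_within_open[of x "ball x e"] e(1) by simp
    moreover have "blinfun_apply (integral (cbox 0 1) (F x)) v = integral {0..1} (\<lambda>t. f' (t, x) v)" for v
    proof -
      have "continuous_on (cbox 0 1) (\<lambda>t. case (x, t) of (x, t) \<Rightarrow> F x t)"
        by (rule continuous_on_compose2[OF contF continuous_on_Pair[OF continuous_on_const continuous_on_id]])
           (use x in auto)
      then have "continuous_on (cbox 0 1) (F x)" by simp
      then have "integral (cbox 0 1) (F x) v = integral (cbox 0 1) (\<lambda>t. F x t v)"
        by (simp add: blinfun_apply_integral integrable_continuous_interval)
      also have "\<dots> = integral {0..1} (\<lambda>t. f' (t, x) v)"
        using F x assms(4) by (auto intro!: integral_cong)
      finally show ?thesis .
    qed
    ultimately show "((\<lambda>x. integral {0..1} (\<lambda>t. f (t, x))) has_derivative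
        (\<lambda>v. integral {0..1} (\<lambda>t. f' (t, x) v))) (at x)"
      by (metis (no_types, lifting) ext)
  qed (use Suc.IH f'_Ck assms in auto)
qed

section \<open>Smoothness of determinant and inverse\<close>

lemma bounded_bilinear_matrix_mult:
  "bounded_bilinear ((**) :: real^'m^'n \<Rightarrow> real^'k^'m \<Rightarrow> real^'k^'n)"
  unfolding bilinear_conv_bounded_bilinear[symmetric] bilinear_def
  by (auto intro!: linearI simp: matrix_add_ldistrib scalar_matrix_assoc matrix_scalar_ac
      matrix_matrix_mult_def vec_eq_iff sum.distrib algebra_simps sum_distrib_left)

lemmas matrix_mult_diff_left = bounded_bilinear.diff_left[OF bounded_bilinear_matrix_mult]
  and matrix_mult_diff_right = bounded_bilinear.diff_right[OF bounded_bilinear_matrix_mult]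
  and matrix_mult_add_left = bounded_bilinear.add_left[OF bounded_bilinear_matrix_mult]
  and matrix_mult_add_right = bounded_bilinear.add_right[OF bounded_bilinear_matrix_mult]
  and matrix_mult_minus_left = bounded_bilinear.minus_left[OF bounded_bilinear_matrix_mult]
  and matrix_mult_minus_right = bounded_bilinear.minus_right[OF bounded_bilinear_matrix_mult]
  and matrix_mult_zero_left = bounded_bilinear.zero_left[OF bounded_bilinear_matrix_mult]
  and matrix_mult_zero_right = bounded_bilinear.zero_right[OF bounded_bilinear_matrix_mult]
  and matrix_mult_scaleR_left = bounded_bilinear.scaleR_left[OF bounded_bilinear_matrix_mult]
  and matrix_mult_scaleR_right = bounded_bilinear.scaleR_right[OF bounded_bilinear_matrix_mult]
  and bounded_linear_matrix_mult_left = bounded_bilinear.bounded_linear_left[OF bounded_bilinear_matrix_mult]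
  and bounded_linear_matrix_mult_right = bounded_bilinear.bounded_linear_right[OF bounded_bilinear_matrix_mult]
  and continuous_on_matrix_mult = bounded_bilinear.continuous_on[OF bounded_bilinear_matrix_mult]
  and Ck_on_matrix_mult = Ck_on_bilinear[OF bounded_bilinear_matrix_mult]

lemma bounded_linear_transpose: "bounded_linear (transpose :: real^'m^'n \<Rightarrow> real^'n^'m)"
  unfolding linear_conv_bounded_linear[symmetric]
  by (rule linearI) (simp_all add: transpose_def vec_eq_iff)

lemmas transpose_add = linear_add[OF bounded_linear.linear[OF bounded_linear_transpose]]
  and transpose_diff = linear_diff[OF bounded_linear.linear[OF bounded_linear_transpose]]
  and transpose_minus = linear_neg[OF bounded_linear.linear[OF bounded_linear_transpose]]

lemma Ck_on_vec_nth:
  fixes f :: "'a::euclidean_space \<Rightarrow> 'b::euclidean_space^'i"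
  assumes "Ck_on k W f" "open W" shows "Ck_on k W (\<lambda>x. f x $ i)"
  by (rule Ck_on_linear_compose[OF bounded_linear_vec_nth assms])

lemma Ck_on_det:
  fixes f :: "'a::euclidean_space \<Rightarrow> real^'n^'n"
  assumes "Ck_on k W f" "open W" shows "Ck_on k W (\<lambda>x. det (f x))"
  unfolding det_def
  by (rule Ck_on_sum[OF Ck_on_bilinear[OF bounded_bilinear_mult Ck_on_const[OF assms(2)]
          Ck_on_prod[OF Ck_on_vec_nth[OF Ck_on_vec_nth[OF assms] assms(2)] assms(2)] assms(2)]
        assms(2)])

lemma continuous_on_det:
  fixes f :: "'a::topological_space \<Rightarrow> real^'n^'n"
  assumes "continuous_on S f" shows "continuous_on S (\<lambda>x. det (f x))"
proof -
  have "continuous_on UNIV (det :: real^'n^'n \<Rightarrow> real)"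
    using Ck_on_det[OF Ck_on_bounded_linear[OF bounded_linear_ident open_UNIV], of 0] by simp
  then show ?thesis using assms by (rule continuous_on_compose2) auto
qed

lemma matrix_inv_mult:
  fixes A :: "real^'n^'n"
  assumes "det A \<noteq> 0" shows "A ** matrix_inv A = mat 1" "matrix_inv A ** A = mat 1"
  using someI_ex[of "\<lambda>B. A ** B = mat 1 \<and> B ** A = mat 1"] assms
  unfolding invertible_det_nz[symmetric] invertible_def matrix_inv_def by auto

lemma matrix_inv_unique:
  fixes A :: "real^'n^'n"
  assumes "A ** B = mat 1" shows "matrix_inv A = B"
proof -
  have "det A \<noteq> 0" using assms invertible_right_inverse invertible_det_nz by blast
  then show ?thesis using assms matrix_inv_mult(2)[of A] by (metis matrix_mul_assoc matrix_mul_lid matrix_mul_rid)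
qed

lemma matrix_inv_component:
  fixes A :: "real^'n^'n"
  assumes "det A \<noteq> 0"
  shows "matrix_inv A $ k $ l = det (\<chi> i j. if j = k then axis l 1 $ i else A $ i $ j) / det A"
proof -
  have "A *v (matrix_inv A *v axis l 1) = axis l 1"
    by (simp add: matrix_vector_mul_assoc matrix_inv_mult[OF assms])
  then have "matrix_inv A *v axis l 1
      = (\<chi> k. det (\<chi> i j. if j = k then axis l 1 $ i else A $ i $ j) / det A)"
    using cramer[OF assms] by blast
  then show ?thesis
    by (metis (no_types, lifting) column_def matrix_vector_mul_component matrix_vector_mult_basis vec_lambda_beta)
qed

text \<open>By Cramer's rule the entries of the inverse are quotients of determinants, and determinants are
polynomials in the entries.\<close>

lemma Ck_on_matrix_inv:
  fixes f :: "'a::euclidean_space \<Rightarrow> real^'n^'n"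
  assumes f: "Ck_on k W f" and W: "open W" and nz: "\<And>x. x \<in> W \<Longrightarrow> det (f x) \<noteq> 0"
  shows "Ck_on k W (\<lambda>x. matrix_inv (f x))"
proof -
  note entries = Ck_on_vec_nth[OF Ck_on_vec_nth[OF f W] W]
  have "Ck_on k W (\<lambda>x. inverse (det (f x)))"
    by (rule Ck_on_compose[OF Ck_on_det[OF f W] Ck_on_inverse W]) (use nz in auto)
  moreover have "Ck_on k W (\<lambda>x. \<chi> i j. if j = m then axis l 1 $ i else f x $ i $ j)" for m l
  proof (intro Ck_on_vec_lambda W)
    show "Ck_on k W (\<lambda>x. if j = m then axis l 1 $ i else f x $ i $ j)" for i j
      by (cases "j = m") (simp_all add: Ck_on_const[OF W] entries)
  qed
  ultimately have "Ck_on k W (\<lambda>x. det (\<chi> i j. if j = m then axis l 1 $ i else f x $ i $ j)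
      * inverse (det (f x)))" for m l
    by (rule Ck_on_bilinear[OF bounded_bilinear_mult Ck_on_det[OF _ W] _ W, rotated])
  then have "Ck_on k W (\<lambda>x. \<chi> m l. det (\<chi> i j. if j = m then axis l 1 $ i else f x $ i $ j)
      * inverse (det (f x)))"
    by (intro Ck_on_vec_lambda W)
  then show ?thesis
    by (rule Ck_on_cong) (use nz W in \<open>simp_all add: vec_eq_iff matrix_inv_component divide_inverse\<close>)
qed

lemma transpose_matrix_inv:
  fixes A :: "real^'n^'n"
  assumes "det A \<noteq> 0" shows "transpose (matrix_inv A) = matrix_inv (transpose A)"
  by (rule matrix_inv_unique[symmetric]) (metis assms matrix_inv_mult(2) matrix_transpose_mul transpose_mat)

lemma commute_matrix_inv:
  fixes A :: "real^'n^'n"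
  assumes "det A \<noteq> 0" "A ** Y = Y ** A" shows "matrix_inv A ** Y = Y ** matrix_inv A"
proof -
  have "matrix_inv A ** Y = matrix_inv A ** (Y ** A) ** matrix_inv A"
    using matrix_inv_mult[OF assms(1)] by (metis matrix_mul_assoc matrix_mul_rid)
  also have "\<dots> = matrix_inv A ** A ** Y ** matrix_inv A"
    by (simp only: assms(2)[symmetric] matrix_mul_assoc)
  also have "\<dots> = Y ** matrix_inv A" by (simp add: matrix_inv_mult[OF assms(1)])
  finally show ?thesis .
qed

section \<open>The matrix exponential\<close>

lemma matrix_power_0: "matrix_power A 0 = mat 1"
  and matrix_power_Suc: "matrix_power A (Suc k) = A ** matrix_power A k"
  by (simp_all add: matrix_power_def)

lemma matrix_power_scaleR: "matrix_power (t *\<^sub>R A) k = t ^ k *\<^sub>R matrix_power A k"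
  by (induction k)
     (simp_all add: matrix_power_0 matrix_power_Suc matrix_mult_scaleR_left matrix_mult_scaleR_right)

text \<open>Submultiplicativity up to a constant is enough for convergence; the extra factor is there because the
Euclidean norm of the identity matrix is in general not 1.\<close>

lemma matrix_power_norm_bound:
  "\<exists>K>0. \<forall>A k. norm (matrix_power (A :: real^'p^'p) k) \<le> (K * norm A) ^ k * norm (mat 1 :: real^'p^'p)"
proof -
  obtain K where K: "K > 0" "\<And>(a :: real^'p^'p) (b :: real^'p^'p). norm (a ** b) \<le> norm a * norm b * K"
    using bounded_bilinear.pos_bounded[OF bounded_bilinear_matrix_mult[where 'm='p and 'n='p and 'k='p]] by auto
  have "norm (matrix_power A k) \<le> (K * norm A) ^ k * norm (mat 1 :: real^'p^'p)" for k and A :: "real^'p^'p"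
  proof (induction k)
    case (Suc k)
    have "norm (matrix_power A (Suc k)) \<le> norm A * norm (matrix_power A k) * K"
      unfolding matrix_power_Suc by (rule K)
    also have "\<dots> = (K * norm A) * norm (matrix_power A k)" by simp
    also have "\<dots> \<le> (K * norm A) * ((K * norm A) ^ k * norm (mat 1 :: real^'p^'p))"
      by (intro mult_left_mono Suc) (use K in simp)
    finally show ?case by simp
  qed (simp add: matrix_power_0)
  then show ?thesis by (intro exI[of _ K] conjI allI K(1))
qed

text \<open>One numerical series majorises the exponential series on a whole ball, which yields summability and,
by the Weierstrass test, continuity.\<close>

lemma exp_m_dominated:
  "\<exists>M. summable M \<and>
    (\<forall>A k. norm A \<le> r \<longrightarrow> norm ((1 / fact k) *\<^sub>R matrix_power (A :: real^'p^'p) k) \<le> M k)"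
proof -
  obtain K where K: "K > 0" "\<And>A k. norm (matrix_power (A :: real^'p^'p) k) \<le> (K * norm A) ^ k * norm (mat 1 :: real^'p^'p)"
    using matrix_power_norm_bound[where 'p='p] by blast
  define M where "M k = norm (mat 1 :: real^'p^'p) * (inverse (fact k) * (K * r) ^ k)" for k
  have "summable M" unfolding M_def by (intro summable_mult summable_exp)
  moreover have "norm ((1 / fact k) *\<^sub>R matrix_power A k) \<le> M k" if "norm A \<le> r" for A :: "real^'p^'p" and k
  proof -
    have "(K * norm A) ^ k \<le> (K * r) ^ k" using K that by (intro power_mono mult_left_mono) auto
    then have "norm (matrix_power A k) \<le> (K * r) ^ k * norm (mat 1 :: real^'p^'p)"
      by (rule order_trans[OF K(2) mult_right_mono[OF _ norm_ge_zero]])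
    then have "inverse (fact k) * norm (matrix_power A k)
        \<le> inverse (fact k) * ((K * r) ^ k * norm (mat 1 :: real^'p^'p))"
      by (rule mult_left_mono) simp
    moreover have "norm ((1 / fact k) *\<^sub>R matrix_power A k) = inverse (fact k) * norm (matrix_power A k)"
      by (simp add: inverse_eq_divide)
    ultimately show ?thesis by (simp only: M_def mult_ac)
  qed
  ultimately show ?thesis by blast
qed

lemma exp_m_summable: "summable (\<lambda>k. (1 / fact k) *\<^sub>R matrix_power (A :: real^'p^'p) k)"
proof -
  obtain M where M: "summable M"
    "\<And>A' k. norm A' \<le> norm A \<Longrightarrow> norm ((1 / fact k) *\<^sub>R matrix_power (A' :: real^'p^'p) k) \<le> M k"
    using exp_m_dominated[of "norm A"] by blast
  show ?thesis by (rule summable_comparison_test'[OF M(1), of 0], rule M(2), rule order_refl)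
qed

lemma exp_m_bounded_linear:
  assumes "bounded_linear h"
  shows "h (exp_m (A :: real^'p^'p)) = (\<Sum>k. h ((1 / fact k) *\<^sub>R matrix_power A k))"
  unfolding exp_m_def by (rule bounded_linear.suminf[OF assms exp_m_summable])

lemma continuous_on_exp_m_UNIV: "continuous_on UNIV (exp_m :: real^'p^'p \<Rightarrow> _)"
proof -
  have "continuous_on (ball 0 r) (exp_m :: real^'p^'p \<Rightarrow> _)" for r
  proof -
    obtain M where M: "summable M"
      "\<And>A k. norm A \<le> r \<Longrightarrow> norm ((1 / fact k) *\<^sub>R matrix_power (A :: real^'p^'p) k) \<le> M k"
      using exp_m_dominated[of r] by blast
    have "continuous_on S (\<lambda>A. matrix_power (A :: real^'p^'p) k)" for k S
      by (induction k) (auto simp: matrix_power_0 matrix_power_Suc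
          intro!: continuous_on_const continuous_on_matrix_mult continuous_on_id)
    then have "continuous_on (ball 0 r) (\<lambda>A. \<Sum>k<n. (1 / fact k) *\<^sub>R matrix_power (A :: real^'p^'p) k)" for n
      by (intro continuous_on_sum continuous_on_scaleR continuous_on_const)
    moreover have "uniform_limit (ball 0 r) (\<lambda>n A. \<Sum>k<n. (1 / fact k) *\<^sub>R matrix_power (A :: real^'p^'p) k)
        (\<lambda>A. \<Sum>k. (1 / fact k) *\<^sub>R matrix_power A k) sequentially"
      by (rule Weierstrass_m_test[OF M(2) M(1)]) simp
    ultimately show ?thesis
      unfolding exp_m_def[abs_def] by (intro uniform_limit_theorem[where F = sequentially]) auto
  qed
  then have "continuous (at A) (exp_m :: real^'p^'p \<Rightarrow> _)" for A
    using continuous_on_eq_continuous_at[OF open_ball, of 0 "norm A + 1" exp_m]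
    by (metis (no_types, opaque_lifting) dist_0_norm less_add_one mem_ball)
  then show ?thesis by (simp add: continuous_at_imp_continuous_on)
qed

lemma continuous_on_exp_m:
  assumes "continuous_on S f" shows "continuous_on S (\<lambda>x. exp_m (f x :: real^'p^'p))"
  by (rule continuous_on_compose2[OF continuous_on_exp_m_UNIV assms]) simp

lemma exp_m_zero [simp]: "exp_m (0 :: real^'p^'p) = mat 1"
proof -
  have "matrix_power (0 :: real^'p^'p) k = (if k = 0 then mat 1 else 0)" for k
    by (cases k) (simp_all add: matrix_power_0 matrix_power_Suc matrix_mult_zero_left)
  then have "exp_m (0 :: real^'p^'p) = (\<Sum>k. if k = 0 then mat 1 else 0)"
    unfolding exp_m_def by (intro suminf_cong) simp
  then show ?thesis using sums_single[of 0 "\<lambda>_. mat 1 :: real^'p^'p"] by (simp add: sums_iff)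
qed

lemma exp_m_commute:
  fixes A B :: "real^'p^'p"
  assumes "A ** B = B ** A" shows "exp_m A ** B = B ** exp_m A"
proof -
  have "matrix_power A k ** B = B ** matrix_power A k" for k
    by (induction k) (simp_all add: matrix_power_0 matrix_power_Suc, metis assms matrix_mul_assoc)
  then show ?thesis
    by (simp add: exp_m_bounded_linear[OF bounded_linear_matrix_mult_left]
        exp_m_bounded_linear[OF bounded_linear_matrix_mult_right]
        matrix_mult_scaleR_left matrix_mult_scaleR_right)
qed

lemma transpose_exp_m: "transpose (exp_m A) = exp_m (transpose A :: real^'p^'p)"
proof -
  have c: "matrix_power A k ** A = A ** matrix_power A k" for k
    by (induction k) (simp_all add: matrix_power_0 matrix_power_Suc, metis matrix_mul_assoc)
  have "transpose (matrix_power A k) = matrix_power (transpose A) k" for k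
    by (induction k) (simp_all add: matrix_power_0 matrix_power_Suc matrix_transpose_mul flip: c)
  then show ?thesis
    by (simp add: exp_m_bounded_linear[OF bounded_linear_transpose] transpose_scalar exp_m_def[of "transpose A"])
qed

text \<open>After applying a linear functional the exponential along a ray becomes a real power series in \<open>t\<close>,
which may be differentiated term by term.\<close>

lemma exp_m_scaleR_has_vector_derivative:
  fixes A :: "real^'p^'p"
  shows "((\<lambda>t. exp_m (t *\<^sub>R A)) has_vector_derivative A ** exp_m (t *\<^sub>R A)) (at t within S)"
proof -
  have "((\<lambda>t. h (exp_m (t *\<^sub>R A))) has_field_derivative h (A ** exp_m (t *\<^sub>R A))) (at t)"
    if h: "bounded_linear h" for h :: "real^'p^'p \<Rightarrow> real"
  proof -
    define c where "c k = h (matrix_power A k) / fact k" for k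
    have c: "h ((1 / fact k) *\<^sub>R matrix_power (s *\<^sub>R A) k) = c k * s ^ k" for s k
      by (simp add: c_def matrix_power_scaleR linear_cmul[OF bounded_linear.linear[OF h]])
    have "summable (\<lambda>k. c k * s ^ k)" for s
      using bounded_linear.summable[OF h exp_m_summable[of "s *\<^sub>R A"]] by (simp only: c)
    then have "((\<lambda>t. \<Sum>k. c k * t ^ k) has_field_derivative (\<Sum>k. diffs c k * t ^ k)) (at t)"
      by (rule termdiffs_strong_converges_everywhere)
    moreover have "(\<Sum>k. c k * s ^ k) = h (exp_m (s *\<^sub>R A))" for s
      by (simp only: exp_m_bounded_linear[OF h] c)
    moreover have "h (A ** ((1 / fact k) *\<^sub>R matrix_power (t *\<^sub>R A) k)) = diffs c k * t ^ k" for k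
      by (simp add: c_def diffs_def matrix_power_scaleR matrix_power_Suc matrix_mult_scaleR_right
          linear_cmul[OF bounded_linear.linear[OF h]] del: of_nat_Suc)
    then have "h (A ** exp_m (t *\<^sub>R A)) = (\<Sum>k. diffs c k * t ^ k)"
      using exp_m_bounded_linear[OF bounded_linear_compose[OF h bounded_linear_matrix_mult_right], of A "t *\<^sub>R A"]
      by simp
    ultimately show ?thesis by simp
  qed
  from this[OF bounded_linear_inner_left]
  have "((\<lambda>t. exp_m (t *\<^sub>R A) \<bullet> b) has_derivative (\<lambda>s. s * ((A ** exp_m (t *\<^sub>R A)) \<bullet> b))) (at t)" for b
    unfolding has_field_derivative_def by (subst mult.commute)
  then have "((\<lambda>t. exp_m (t *\<^sub>R A) \<bullet> b) has_derivative (\<lambda>s. s *\<^sub>R (A ** exp_m (t *\<^sub>R A)) \<bullet> b)) (at t within S)" for b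
    by (simp only: inner_scaleR_left has_derivative_at_withinI)
  then show ?thesis
    unfolding has_vector_derivative_def has_derivative_componentwise_within[of "\<lambda>t. exp_m (t *\<^sub>R A)"]
    by blast
qed

text \<open>Caratheodory's criterion in finite dimension. Continuity of the linear factors is only required in
each fixed direction, which suffices because a linear map is determined by its values on a basis.\<close>

lemma has_derivative_if_factor:
  fixes f :: "'a::euclidean_space \<Rightarrow> 'b::real_normed_vector"
  assumes eq: "\<And>y. f y - f x = G y (y - x)"
    and lin: "\<And>y. linear (G y)"
    and cont: "\<And>v. continuous (at x) (\<lambda>y. G y v)"
  shows "(f has_derivative G x) (at x)"
  unfolding has_derivative_iff_norm
proof
  show "bounded_linear (G x)" using lin by (simp add: linear_conv_bounded_linear)
  have le: "norm ((f y - f x) - G x (y - x)) / norm (y - x) \<le> (\<Sum>b\<in>Basis. norm (G y b - G x b))" for y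
  proof -
    have "(f y - f x) - G x (y - x) = (\<Sum>b\<in>Basis. ((y - x) \<bullet> b) *\<^sub>R (G y b - G x b))"
      unfolding eq linear_eq_sum_Basis[OF lin, of _ "y - x"]
      by (simp add: sum_subtractf scaleR_diff_right)
    also have "norm \<dots> \<le> (\<Sum>b\<in>Basis. norm (y - x) * norm (G y b - G x b))"
      by (rule sum_norm_le) (auto intro!: mult_right_mono Basis_le_norm)
    also have "\<dots> = (\<Sum>b\<in>Basis. norm (G y b - G x b)) * norm (y - x)"
      by (simp add: sum_distrib_left mult.commute)
    finally show ?thesis
      by (cases "y = x") (simp_all add: divide_le_eq sum_nonneg)
  qed
  have lim: "((\<lambda>y. \<Sum>b\<in>Basis. norm (G y b - G x b)) \<longlongrightarrow> (\<Sum>b\<in>(Basis::'a set). norm (G x b - G x b))) (at x)"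
    using cont unfolding continuous_within by (intro tendsto_intros)
  show "((\<lambda>y. norm ((f y - f x) - G x (y - x)) / norm (y - x)) \<longlongrightarrow> 0) (at x)"
  proof (rule Lim_null_comparison[OF always_eventually])
    show "\<forall>y. norm (norm ((f y - f x) - G x (y - x)) / norm (y - x)) \<le> (\<Sum>b\<in>Basis. norm (G y b - G x b))"
      using le by (simp only: real_norm_def abs_divide abs_norm_cancel) blast
    show "((\<lambda>y. \<Sum>b\<in>Basis. norm (G y b - G x b)) \<longlongrightarrow> 0) (at x)"
      using lim by simp
  qed
qed

lemma exp_m_affine_has_vector_derivative:
  fixes A :: "real^'p^'p"
  shows "((\<lambda>u. exp_m ((a + c * u) *\<^sub>R A)) has_vector_derivative c *\<^sub>R (A ** exp_m ((a + c * u) *\<^sub>R A))) (at u within S)"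
proof -
  have "((\<lambda>u. a + c * u) has_vector_derivative c) (at u within S)"
    by (auto intro!: derivative_eq_intros simp flip: has_real_derivative_iff_has_vector_derivative)
  from vector_diff_chain_within[OF this exp_m_scaleR_has_vector_derivative] show ?thesis
    by (simp add: o_def)
qed

text \<open>The product interpolates between the two exponentials. For \<open>A = B\<close> it is constant, which gives the
addition rule on a line; for \<open>a = 1\<close>, \<open>b = 0\<close> its derivative is the integrand of Duhamel's formula.\<close>

lemma exp_m_interpolation_has_vector_derivative:
  fixes A B :: "real^'p^'p"
  shows "((\<lambda>u. exp_m ((a - u) *\<^sub>R A) ** exp_m ((b + u) *\<^sub>R B)) has_vector_derivative
    exp_m ((a - u) *\<^sub>R A) ** (B - A) ** exp_m ((b + u) *\<^sub>R B)) (at u within S)"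
proof -
  have "((\<lambda>u. exp_m ((a - u) *\<^sub>R A) ** exp_m ((b + u) *\<^sub>R B)) has_vector_derivative
    exp_m ((a - u) *\<^sub>R A) ** (B ** exp_m ((b + u) *\<^sub>R B))
      + - (A ** exp_m ((a - u) *\<^sub>R A)) ** exp_m ((b + u) *\<^sub>R B)) (at u within S)"
    using bounded_bilinear.has_vector_derivative[OF bounded_bilinear_matrix_mult
        exp_m_affine_has_vector_derivative[of a "-1" A u S] exp_m_affine_has_vector_derivative[of b 1 B u S]]
    by simp
  moreover have "A ** exp_m ((a - u) *\<^sub>R A) = exp_m ((a - u) *\<^sub>R A) ** A"
    by (rule exp_m_commute[symmetric]) (simp add: matrix_mult_scaleR_left matrix_mult_scaleR_right)
  ultimately show ?thesis
    by (simp add: matrix_mult_diff_left matrix_mult_diff_right matrix_mult_minus_left matrix_mul_assoc)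
qed

lemma eq_if_zero_vector_derivative:
  fixes f :: "real \<Rightarrow> 'a::real_normed_vector"
  assumes "convex S" "\<And>u. u \<in> S \<Longrightarrow> (f has_vector_derivative 0) (at u within S)" "x \<in> S" "y \<in> S"
  shows "f x = f y"
proof (rule has_vector_derivative_zero_constant[OF assms(1,2)])
  fix c assume "\<And>u. u \<in> S \<Longrightarrow> f u = c"
  then show ?thesis using assms(3,4) by simp
qed

lemma exp_m_scaleR_mult:
  fixes A :: "real^'p^'p"
  shows "exp_m (s *\<^sub>R A) ** exp_m (t *\<^sub>R A) = exp_m ((s + t) *\<^sub>R A)"
proof -
  have "((\<lambda>u. exp_m ((s - u) *\<^sub>R A) ** exp_m ((t + u) *\<^sub>R A)) has_vector_derivative 0) (at u within UNIV)" for u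
    using exp_m_interpolation_has_vector_derivative[of s A t A u UNIV]
    by (simp add: matrix_mult_zero_left matrix_mult_zero_right)
  from eq_if_zero_vector_derivative[OF convex_UNIV this UNIV_I UNIV_I, of 0 s]
  show ?thesis by (simp add: add.commute)
qed

lemma exp_m_inverse:
  fixes A :: "real^'p^'p"
  shows "exp_m (- A) ** exp_m A = mat 1" "exp_m A ** exp_m (- A) = mat 1"
  using exp_m_scaleR_mult[of "-1" A 1] exp_m_scaleR_mult[of 1 A "-1"] by simp_all

text \<open>Duhamel's formula in its exact form for two matrices: the right-hand side is linear in \<open>B - A\<close>
with a coefficient that is continuous in \<open>B\<close>, as Caratheodory's criterion requires.\<close>

lemma exp_m_diff_eq_integral:
  fixes A B :: "real^'p^'p"
  shows "exp_m B - exp_m A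
    = integral {0..1} (\<lambda>t. exp_m ((1 - t) *\<^sub>R A) ** (B - A) ** exp_m (t *\<^sub>R B))"
proof -
  have "((\<lambda>t. exp_m ((1 - t) *\<^sub>R A) ** (B - A) ** exp_m ((0 + t) *\<^sub>R B)) has_integral
     exp_m ((1 - 1) *\<^sub>R A) ** exp_m ((0 + 1) *\<^sub>R B) - exp_m ((1 - 0) *\<^sub>R A) ** exp_m ((0 + 0) *\<^sub>R B)) {0..1}"
    by (rule fundamental_theorem_of_calculus[OF zero_le_one exp_m_interpolation_has_vector_derivative])
  then show ?thesis by (simp add: integral_unique)
qed

lemma exp_m_has_derivative:
  fixes A :: "real^'p^'p"
  shows "(exp_m has_derivative
    (\<lambda>H. integral {0..1} (\<lambda>t. exp_m ((1 - t) *\<^sub>R A) ** H ** exp_m (t *\<^sub>R A)))) (at A)"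
proof (rule has_derivative_if_factor[where
      G = "\<lambda>B H. integral {0..1} (\<lambda>t. exp_m ((1 - t) *\<^sub>R A) ** H ** exp_m (t *\<^sub>R B))"])
  show "exp_m B - exp_m A = integral {0..1} (\<lambda>t. exp_m ((1 - t) *\<^sub>R A) ** (B - A) ** exp_m (t *\<^sub>R B))" for B
    by (rule exp_m_diff_eq_integral)
  have cont: "continuous_on S (\<lambda>(B, t). exp_m ((1 - t) *\<^sub>R A) ** H ** exp_m (t *\<^sub>R B))" for H S
    unfolding split_beta
    by (intro continuous_on_matrix_mult continuous_on_exp_m continuous_on_scaleR continuous_intros)
  have int: "(\<lambda>t. exp_m ((1 - t) *\<^sub>R A) ** H ** exp_m (t *\<^sub>R B)) integrable_on {0..1}" for H B
    by (intro integrable_continuous_interval continuous_on_matrix_mult continuous_on_exp_m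
        continuous_on_scaleR continuous_intros)
  show "linear (\<lambda>H. integral {0..1} (\<lambda>t. exp_m ((1 - t) *\<^sub>R A) ** H ** exp_m (t *\<^sub>R B)))" for B
    by (rule linearI)
       (simp_all add: matrix_mult_add_left matrix_mult_add_right matrix_mult_scaleR_left
         matrix_mult_scaleR_right integral_add[OF int int])
  fix H :: "real^'p^'p"
  have "continuous_on UNIV (\<lambda>B. integral (cbox 0 1) (\<lambda>t. exp_m ((1 - t) *\<^sub>R A) ** H ** exp_m (t *\<^sub>R B)))"
    by (rule integral_continuous_on_param[OF cont])
  then show "continuous (at A) (\<lambda>B. integral {0..1} (\<lambda>t. exp_m ((1 - t) *\<^sub>R A) ** H ** exp_m (t *\<^sub>R B)))"
    by (simp add: continuous_on_eq_continuous_at)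
qed

text \<open>Bootstrapping: the derivative is an integral of products of exponentials, so it inherits the class
C^k from the exponential itself.\<close>

lemma Ck_on_exp_m_UNIV: "Ck_on k UNIV (exp_m :: real^'p^'p \<Rightarrow> real^'p^'p)"
proof (induction k)
  case (Suc k)
  show ?case
  proof (rule Ck_on_SucI[OF exp_m_has_derivative])
    fix H :: "real^'p^'p"
    have pair: "Ck_on k UNIV (\<lambda>p :: real \<times> (real^'p^'p). exp_m (h (fst p) *\<^sub>R snd p))"
      if "Ck_on k UNIV h" for h :: "real \<Rightarrow> real"
      by (rule Ck_on_compose[OF Ck_on_bilinear[OF bounded_bilinear_scaleR
              Ck_on_compose[OF Ck_on_bounded_linear[OF bounded_linear_fst open_UNIV] that open_UNIV open_UNIV UNIV_I]
              Ck_on_bounded_linear[OF bounded_linear_snd open_UNIV] open_UNIV]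
            Suc.IH open_UNIV open_UNIV UNIV_I])
    have "Ck_on k UNIV (\<lambda>t :: real. 1 + (- 1) * t)"
      by (intro Ck_on_add Ck_on_const Ck_on_bounded_linear bounded_linear_mult_right open_UNIV)
    from pair[OF this] pair[OF Ck_on_bounded_linear[OF bounded_linear_ident open_UNIV]]
    have "Ck_on k UNIV (\<lambda>p :: real \<times> (real^'p^'p). exp_m ((1 + (- 1) * fst p) *\<^sub>R snd p) ** H ** exp_m (fst p *\<^sub>R snd p))"
      by (intro Ck_on_matrix_mult Ck_on_const open_UNIV)
    from Ck_on_integral[OF this open_UNIV open_UNIV subset_UNIV]
    show "Ck_on k UNIV (\<lambda>A. integral {0..1} (\<lambda>t. exp_m ((1 - t) *\<^sub>R A) ** H ** exp_m (t *\<^sub>R A)))"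
      by simp
  qed simp
qed (simp add: continuous_on_exp_m_UNIV)

lemma Ck_on_exp_m:
  assumes "Ck_on k W f" "open W" shows "Ck_on k W (\<lambda>x. exp_m (f x :: real^'p^'p))"
  by (rule Ck_on_compose[OF assms(1) Ck_on_exp_m_UNIV assms(2) open_UNIV UNIV_I])

text \<open>If the velocity commutes with the position, the integrand in the derivative of the exponential does
not depend on the integration variable and the scalar chain rule reappears.\<close>

lemma exp_m_commuting_has_vector_derivative:
  fixes f :: "real \<Rightarrow> real^'p^'p"
  assumes "(f has_vector_derivative f') (at s within S)" "f s ** f' = f' ** f s"
  shows "((\<lambda>s. exp_m (f s)) has_vector_derivative f' ** exp_m (f s)) (at s within S)"
proof -
  have "exp_m ((1 - t) *\<^sub>R f s) ** f' ** exp_m (t *\<^sub>R f s) = f' ** exp_m (f s)" for t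
  proof -
    have "exp_m ((1 - t) *\<^sub>R f s) ** f' = f' ** exp_m ((1 - t) *\<^sub>R f s)"
      by (rule exp_m_commute) (simp add: assms(2) matrix_mult_scaleR_left matrix_mult_scaleR_right)
    then show ?thesis by (simp add: exp_m_scaleR_mult flip: matrix_mul_assoc)
  qed
  then show ?thesis
    using vector_derivative_diff_chain_within[OF assms(1) has_derivative_at_withinI[OF exp_m_has_derivative]]
    by (simp add: o_def)
qed

section \<open>The logarithm as an integral\<close>

text \<open>The matrices that are joined to the identity by a segment of invertible matrices. A singular matrix
on the segment amounts to an eigenvalue \<open>- (1 - t) / t\<close> of \<open>M\<close>, and these numbers run through the
closed negative real axis.\<close>

definition log_domain :: "(real^'p^'p) set" where
  "log_domain = {M. \<forall>t\<in>{0..1}. det (mat 1 + t *\<^sub>R (M - mat 1)) \<noteq> 0}"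

text \<open>For a number \<open>M\<close> this is the derivative of \<open>Ln (1 + t (M - 1))\<close> with respect to \<open>t\<close>.\<close>

definition log_kernel :: "real^'p^'p \<Rightarrow> real \<Rightarrow> real^'p^'p" where
  "log_kernel M t = (M - mat 1) ** matrix_inv (mat 1 + t *\<^sub>R (M - mat 1))"

definition log_int :: "real^'p^'p \<Rightarrow> real^'p^'p" where
  "log_int M = integral {0..1} (log_kernel M)"

text \<open>The tube lemma: a condition imposed at all points of a compact parameter set is stable under small
perturbations.\<close>

lemma open_Ball_compact:
  assumes g: "continuous_on UNIV (\<lambda>(x, t). g x t)" and "open V" "compact K"
  shows "open {x. \<forall>t\<in>K. g x t \<in> V}"
proof (subst open_subopen, intro ballI)
  fix x assume "x \<in> {x. \<forall>t\<in>K. g x t \<in> V}"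
  then have "{x} \<times> K \<subseteq> (\<lambda>(x, t). g x t) -` V" by auto
  moreover have "open ((\<lambda>(x, t). g x t) -` V)"
    using g \<open>open V\<close> continuous_on_open_vimage[OF open_UNIV] by force
  ultimately have "\<exists>X. x \<in> X \<and> open X \<and> X \<times> K \<subseteq> (\<lambda>(x, t). g x t) -` V"
    by (intro Elementary_Topology.tube_lemma \<open>compact K\<close>)
  then obtain X where "x \<in> X" "open X" "X \<times> K \<subseteq> (\<lambda>(x, t). g x t) -` V"
    by blast
  then show "\<exists>T. open T \<and> x \<in> T \<and> T \<subseteq> {x. \<forall>t\<in>K. g x t \<in> V}"
    by (intro exI[of _ X]) auto
qed

lemma open_nonsingular: "open {M :: real^'p^'p. det M \<noteq> 0}"
  using continuous_on_open_vimage[OF open_UNIV, of "det :: real^'p^'p \<Rightarrow> real"]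
    continuous_on_det[OF continuous_on_id, of UNIV] open_Compl[OF closed_singleton[of "0::real"]]
  by (force simp: vimage_def)

lemma open_log_domain: "open (log_domain :: (real^'p^'p) set)"
proof -
  have "continuous_on UNIV (\<lambda>(M :: real^'p^'p, t). mat 1 + t *\<^sub>R (M - mat 1))"
    unfolding split_beta by (intro continuous_intros)
  from open_Ball_compact[OF this open_nonsingular compact_Icc, of 0 1] show ?thesis
    by (simp add: log_domain_def)
qed

lemma mat_1_in_log_domain: "mat 1 \<in> log_domain"
  by (simp add: log_domain_def)

lemma Ck_on_log_kernel:
  "Ck_on k {p. det (mat 1 + fst p *\<^sub>R (snd p - mat 1)) \<noteq> 0} (\<lambda>p. (log_kernel (snd p) (fst p) :: real^'p^'p))"
  and open_log_kernel_domain: "open {p :: real \<times> (real^'p^'p). det (mat 1 + fst p *\<^sub>R (snd p - mat 1)) \<noteq> 0}"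
proof -
  let ?V = "{p :: real \<times> (real^'p^'p). det (mat 1 + fst p *\<^sub>R (snd p - mat 1)) \<noteq> 0}"
  have "continuous_on UNIV (\<lambda>p :: real \<times> (real^'p^'p). mat 1 + fst p *\<^sub>R (snd p - mat 1))"
    by (intro continuous_intros)
  then have "open ((\<lambda>p :: real \<times> (real^'p^'p). mat 1 + fst p *\<^sub>R (snd p - mat 1)) -` {M. det M \<noteq> 0})"
    using continuous_on_open_vimage[OF open_UNIV] open_nonsingular by force
  then show V: "open ?V" by (simp add: vimage_def)
  have N: "Ck_on k ?V (\<lambda>p. snd p + (- mat 1))"
    by (intro Ck_on_add Ck_on_const Ck_on_bounded_linear bounded_linear_snd V)
  have I: "Ck_on k ?V (\<lambda>p. matrix_inv (mat 1 + fst p *\<^sub>R (snd p + (- mat 1))))"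
    by (intro Ck_on_matrix_inv Ck_on_add Ck_on_const Ck_on_bilinear[OF bounded_bilinear_scaleR]
        Ck_on_bounded_linear[OF bounded_linear_fst] N V) simp
  show "Ck_on k ?V (\<lambda>p. log_kernel (snd p) (fst p))"
    by (rule Ck_on_cong[OF Ck_on_matrix_mult[OF N I V] _ V]) (simp add: log_kernel_def)
qed

lemma Ck_on_log_int: "Ck_on k log_domain (log_int :: real^'p^'p \<Rightarrow> real^'p^'p)"
proof -
  have "{0..1} \<times> log_domain \<subseteq> {p :: real \<times> (real^'p^'p). det (mat 1 + fst p *\<^sub>R (snd p - mat 1)) \<noteq> 0}"
    by (auto simp: log_domain_def)
  from Ck_on_integral[OF Ck_on_log_kernel open_log_kernel_domain open_log_domain this]
  show ?thesis unfolding log_int_def[abs_def] by simp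
qed

lemma continuous_on_log_kernel:
  assumes "M \<in> log_domain" shows "continuous_on {0..1} (log_kernel M)"
proof -
  have "continuous_on {0..1} (\<lambda>t. log_kernel (snd (t, M)) (fst (t, M)))"
    by (rule continuous_on_compose2[OF Ck_on_imp_continuous_on[OF Ck_on_log_kernel[of 0]]
          continuous_on_Pair[OF continuous_on_id continuous_on_const]])
       (use assms in \<open>auto simp: log_domain_def\<close>)
  then show ?thesis by simp
qed

lemma log_kernel_commute:
  fixes M Y :: "real^'p^'p"
  assumes M: "M \<in> log_domain" and c: "M ** Y = Y ** M" and t: "t \<in> {0..1}"
  shows "log_kernel M t ** Y = Y ** log_kernel M t"
proof -
  have d: "det (mat 1 + t *\<^sub>R (M - mat 1)) \<noteq> 0" using M t by (auto simp: log_domain_def)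
  have "(mat 1 + t *\<^sub>R (M - mat 1)) ** Y = Y ** (mat 1 + t *\<^sub>R (M - mat 1))"
    by (simp add: matrix_mult_add_left matrix_mult_add_right matrix_mult_diff_left
        matrix_mult_diff_right matrix_mult_scaleR_left matrix_mult_scaleR_right c)
  from commute_matrix_inv[OF d this]
  have "log_kernel M t ** Y = (M - mat 1) ** Y ** matrix_inv (mat 1 + t *\<^sub>R (M - mat 1))"
    unfolding log_kernel_def by (simp flip: matrix_mul_assoc)
  also have "(M - mat 1) ** Y = Y ** (M - mat 1)"
    by (simp add: matrix_mult_diff_left matrix_mult_diff_right c)
  finally show ?thesis unfolding log_kernel_def by (simp add: matrix_mul_assoc)
qed

text \<open>Everything built from \<open>M\<close> by limits and algebra commutes with what commutes with \<open>M\<close>. The upper limit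
is variable because the partial integral is differentiated with respect to it.\<close>

lemma integral_log_kernel_commute:
  fixes M Y :: "real^'p^'p"
  assumes M: "M \<in> log_domain" and c: "M ** Y = Y ** M" and s: "s \<in> {0..1}"
  shows "integral {0..s} (log_kernel M) ** Y = Y ** integral {0..s} (log_kernel M)"
proof -
  have int: "log_kernel M integrable_on {0..s}"
    using s by (intro integrable_continuous_interval continuous_on_subset[OF continuous_on_log_kernel[OF M]]) auto
  have "log_kernel M t ** Y = Y ** log_kernel M t" if "t \<in> {0..s}" for t
    by (rule log_kernel_commute[OF M c]) (use s that in auto)
  then have "integral {0..s} (\<lambda>t. log_kernel M t ** Y) = integral {0..s} (\<lambda>t. Y ** log_kernel M t)"
    by (rule integral_cong)
  then show ?thesis
    using integral_linear[OF int bounded_linear_matrix_mult_left[of Y]]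
      integral_linear[OF int bounded_linear_matrix_mult_right[of Y]]
    by (simp add: o_def)
qed

lemma log_int_commute:
  fixes M Y :: "real^'p^'p"
  assumes "M \<in> log_domain" "M ** Y = Y ** M" shows "log_int M ** Y = Y ** log_int M"
  using integral_log_kernel_commute[OF assms, of 1] by (simp add: log_int_def)

lemma transpose_log_int:
  fixes M :: "real^'p^'p"
  assumes M: "M \<in> log_domain" shows "transpose (log_int M) = log_int (transpose M)"
proof -
  have "transpose (log_kernel M t) = log_kernel (transpose M) t" if t: "t \<in> {0..1}" for t
  proof -
    let ?N = "mat 1 + t *\<^sub>R (M - mat 1)"
    have d: "det ?N \<noteq> 0" using M t by (auto simp: log_domain_def)
    have tr: "transpose ?N = mat 1 + t *\<^sub>R (transpose M - mat 1)"
      by (simp add: transpose_add transpose_diff transpose_scalar)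
    have "(M - mat 1) ** matrix_inv ?N = matrix_inv ?N ** (M - mat 1)"
      by (rule commute_matrix_inv[OF d, symmetric])
         (simp add: matrix_mult_add_left matrix_mult_add_right
          matrix_mult_scaleR_left matrix_mult_scaleR_right)
    then show ?thesis
      by (simp add: log_kernel_def matrix_transpose_mul transpose_matrix_inv[OF d] tr transpose_diff)
  qed
  then have "integral {0..1} (\<lambda>t. transpose (log_kernel M t)) = log_int (transpose M)"
    unfolding log_int_def by (rule integral_cong)
  then show ?thesis
    using integral_linear[OF integrable_continuous_interval[OF continuous_on_log_kernel[OF M]] bounded_linear_transpose]
    by (simp add: log_int_def o_def)
qed

text \<open>The integral over \<open>{0..s}\<close> is the logarithm of the point \<open>I + s (M - I)\<close> of the segment: the product of
\<open>exp (- L s)\<close> with that point has derivative zero and equals \<open>I\<close> at \<open>s = 0\<close>.\<close>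

lemma exp_m_log_int:
  fixes M :: "real^'p^'p"
  assumes M: "M \<in> log_domain" shows "exp_m (log_int M) = M"
proof -
  define N where "N = M - mat 1"
  define L where "L s = integral {0..s} (log_kernel M)" for s
  define f where "f s = exp_m (- L s) ** (mat 1 + s *\<^sub>R N)" for s
  have "(f has_vector_derivative 0) (at s within {0..1})" if s: "s \<in> {0..1}" for s
  proof -
    have kM: "log_kernel M s ** M = M ** log_kernel M s"
      by (rule log_kernel_commute[OF M refl s])
    have Lk: "L s ** log_kernel M s = log_kernel M s ** L s"
      unfolding L_def by (rule integral_log_kernel_commute[OF M kM[symmetric] s])
    have "(L has_vector_derivative log_kernel M s) (at s within {0..1})"
      unfolding L_def by (rule integral_has_vector_derivative[OF continuous_on_log_kernel[OF M] s])
    then have "((\<lambda>s. exp_m (- L s)) has_vector_derivative (- log_kernel M s) ** exp_m (- L s)) (at s within {0..1})"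
      by (intro exp_m_commuting_has_vector_derivative has_vector_derivative_minus)
         (simp_all add: matrix_mult_minus_left matrix_mult_minus_right Lk)
    moreover have "((\<lambda>s. mat 1 + s *\<^sub>R N) has_vector_derivative N) (at s within {0..1})"
      by (auto intro!: derivative_eq_intros)
    ultimately have "(f has_vector_derivative
        exp_m (- L s) ** N + (- log_kernel M s) ** exp_m (- L s) ** (mat 1 + s *\<^sub>R N)) (at s within {0..1})"
      unfolding f_def by (rule bounded_bilinear.has_vector_derivative[OF bounded_bilinear_matrix_mult])
    moreover have "log_kernel M s ** exp_m (- L s) = exp_m (- L s) ** log_kernel M s"
      by (rule exp_m_commute[symmetric]) (simp add: matrix_mult_minus_left matrix_mult_minus_right Lk)
    moreover have "log_kernel M s ** (mat 1 + s *\<^sub>R N) = N"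
      using M s matrix_inv_mult(2)[of "mat 1 + s *\<^sub>R N"]
      by (simp add: log_kernel_def log_domain_def N_def flip: matrix_mul_assoc)
    ultimately show ?thesis by (simp add: matrix_mult_minus_left flip: matrix_mul_assoc)
  qed
  from eq_if_zero_vector_derivative[of "{0..1}" f 1 0, OF _ this]
  have "exp_m (- log_int M) ** M = mat 1"
    by (simp add: f_def L_def log_int_def N_def)
  then have "exp_m (log_int M) ** (exp_m (- log_int M) ** M) = exp_m (log_int M)" by simp
  then show ?thesis by (simp add: matrix_mul_assoc exp_m_inverse)
qed

text \<open>The matrices recovered from their exponential by following the curve \<open>exp (s X)\<close> from \<open>I\<close>. Compared with
a condition on the spectrum of \<open>X\<close>, this form makes openness and star-shapedness evident.\<close>

definition exp_domain :: "(real^'p^'p) set" where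
  "exp_domain = {X. \<forall>s\<in>{0..1}. exp_m (s *\<^sub>R X) \<in> log_domain}"

lemma open_exp_domain: "open (exp_domain :: (real^'p^'p) set)"
proof -
  have "continuous_on UNIV (\<lambda>(X :: real^'p^'p, s). exp_m (s *\<^sub>R X))"
    unfolding split_beta by (intro continuous_on_exp_m continuous_intros)
  from open_Ball_compact[OF this open_log_domain compact_Icc, of 0 1] show ?thesis
    by (simp add: exp_domain_def)
qed

lemma scaleR_in_exp_domain: "X \<in> exp_domain \<Longrightarrow> c \<in> {0..1} \<Longrightarrow> c *\<^sub>R X \<in> exp_domain"
  by (simp add: exp_domain_def mult_le_one)

lemma exp_m_in_log_domain: "X \<in> exp_domain \<Longrightarrow> exp_m X \<in> log_domain"
  unfolding exp_domain_def by (drule CollectD, drule bspec[where x = 1]) simp_all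

text \<open>Let \<open>G s\<close> be the logarithm of \<open>exp (s X)\<close>. All matrices involved commute, so differentiating
\<open>exp (G s) = exp (s X)\<close> gives \<open>G' = X\<close>; since \<open>G 0 = 0\<close>, the claim is \<open>G 1 = X\<close>.\<close>

lemma log_int_exp_m:
  fixes X :: "real^'p^'p"
  assumes X: "X \<in> exp_domain" shows "log_int (exp_m X) = X"
proof -
  define E where "E s = exp_m (s *\<^sub>R X)" for s
  define G where "G s = log_int (E s)" for s
  have E: "E s \<in> log_domain" if "s \<in> {0..1}" for s
    using X that by (simp add: exp_domain_def E_def)
  have expG: "exp_m (G s) = E s" if "s \<in> {0..1}" for s
    unfolding G_def by (rule exp_m_log_int[OF E[OF that]])
  have EX: "E s ** X = X ** E s" for s
    unfolding E_def by (rule exp_m_commute) (simp add: matrix_mult_scaleR_left matrix_mult_scaleR_right)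
  have GX: "G s ** X = X ** G s" if "s \<in> {0..1}" for s
    unfolding G_def by (rule log_int_commute[OF E[OF that] EX])
  have EG: "E s ** G u = G u ** E s" if "u \<in> {0..1}" for s u
    unfolding E_def
    by (rule exp_m_commute) (simp add: matrix_mult_scaleR_left matrix_mult_scaleR_right GX[OF that])
  have GG: "G s ** G u = G u ** G s" if "s \<in> {0..1}" "u \<in> {0..1}" for s u
    unfolding G_def[of s] by (rule log_int_commute[OF E[OF that(1)] EG[OF that(2)]])
  have "((\<lambda>s. G s - s *\<^sub>R X) has_vector_derivative 0) (at s within {0..1})" if s: "s \<in> {0..1}" for s
  proof -
    have dE: "(E has_vector_derivative X ** E s) (at s within {0..1})"
      unfolding E_def by (rule exp_m_scaleR_has_vector_derivative)
    have "(log_int has_derivative frechet_derivative log_int (at (E s))) (at (E s) within E ` {0..1})"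
      by (rule has_derivative_at_withinI[OF Ck_on_has_derivative[OF Ck_on_log_int[of "Suc 0"] E[OF s]]])
    from vector_derivative_diff_chain_within[OF dE this]
    obtain G' where dG: "(G has_vector_derivative G') (at s within {0..1})"
      unfolding G_def[abs_def] o_def by blast
    have uniq: "a = b" if "(h has_vector_derivative a) (at s within {0..1})"
      "(h has_vector_derivative b) (at s within {0..1})" for h and a b :: "real^'p^'p"
      using vector_derivative_unique_within_closed_interval[of 0 1 s h a b] that s by simp
    \<comment> \<open>The velocity commutes with \<open>G s\<close>: the commutator with \<open>G s\<close> is linear and vanishes along the curve.\<close>
    have bl: "bounded_linear (\<lambda>Y. Y ** G s - G s ** Y)"
      by (intro bounded_linear_sub bounded_linear_matrix_mult_left bounded_linear_matrix_mult_right)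
    have GG0: "G u ** G s - G s ** G u = 0" if "u \<in> {0..1}" for u
      using GG[OF s that] by simp
    have "((\<lambda>u. 0) has_vector_derivative G' ** G s - G s ** G') (at s within {0..1})"
      by (rule has_vector_derivative_transform[OF s GG0[symmetric] bounded_linear.has_vector_derivative[OF bl dG]])
    from uniq[OF this has_vector_derivative_const] have "G s ** G' = G' ** G s" by simp
    from exp_m_commuting_has_vector_derivative[OF dG this]
    have "((\<lambda>s. exp_m (G s)) has_vector_derivative G' ** E s) (at s within {0..1})"
      by (simp only: expG[OF s])
    moreover have "((\<lambda>s. exp_m (G s)) has_vector_derivative X ** E s) (at s within {0..1})"
      by (rule has_vector_derivative_transform[OF s _ dE]) (simp add: expG)
    ultimately have "G' ** E s = X ** E s" by (rule uniq)
    then have "G' ** (E s ** exp_m (- (s *\<^sub>R X))) = X ** (E s ** exp_m (- (s *\<^sub>R X)))"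
      by (simp add: matrix_mul_assoc)
    then have "G' = X" by (simp add: E_def exp_m_inverse)
    then show ?thesis using dG by (auto intro!: derivative_eq_intros)
  qed
  from eq_if_zero_vector_derivative[of "{0..1}" _ 1 0, OF _ this]
  have "G 1 - X = G 0" by simp
  also have "G 0 = 0"
    by (simp add: G_def E_def log_int_def log_kernel_def[abs_def] matrix_mult_zero_left)
  finally show ?thesis by (simp add: G_def E_def)
qed

section \<open>Eigenvectors and the principal logarithm\<close>

text \<open>A family, rather than a set, of vectors is needed, because the iterates of a matrix on a vector may
repeat.\<close>

lemma finite_sequence_dependent:
  fixes a :: "nat \<Rightarrow> 'a::euclidean_space"
  obtains c :: "nat \<Rightarrow> real" and n i where "i \<le> n" "c i \<noteq> 0" "(\<Sum>i\<le>n. c i *\<^sub>R a i) = 0"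
proof (cases "inj_on a {..DIM('a)}")
  case True
  then have "card (a ` {..DIM('a)}) > DIM('a)" by (simp add: card_image)
  then have "dependent (a ` {..DIM('a)})" using dependent_biggerset by blast
  then obtain u v where v: "v \<in> a ` {..DIM('a)}" "u v \<noteq> 0" and "(\<Sum>v\<in>a ` {..DIM('a)}. u v *\<^sub>R v) = 0"
    using dependent_finite[of "a ` {..DIM('a)}"] by auto
  then have "(\<Sum>i\<le>DIM('a). u (a i) *\<^sub>R a i) = 0" by (simp add: sum.reindex[OF True])
  then show ?thesis using that[of _ "DIM('a)" "\<lambda>i. u (a i)"] v by auto
next
  case False
  then obtain i j where ij: "i \<noteq> j" "a i = a j" by (auto simp: inj_on_def)
  define c :: "nat \<Rightarrow> real" where "c k = (if k = i then 1 else 0) - (if k = j then 1 else 0)" for k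
  have "(\<Sum>k\<le>max i j. c k *\<^sub>R a k) = 0"
    by (simp add: c_def scaleR_diff_left sum_subtractf if_distrib[of "\<lambda>r. r *\<^sub>R _"] ij cong: if_cong)
  then show ?thesis using that[of i "max i j" c] ij by (simp add: c_def)
qed

lemma scaleR_eq_smult: "r *\<^sub>R (x :: complex^'n) = complex_of_real r *s x"
  by (simp only: vec_eq_iff vector_scaleR_component vector_smult_component
      scaleR_conv_of_real[where 'a = complex] simp_thms)

text \<open>Among the nonzero polynomials \<open>q\<close> with \<open>q(A) v = 0\<close> choose one of least degree and split off a root:
\<open>q = (x - z) r\<close>. Then \<open>r(A) v\<close> is nonzero by minimality, lies in the subspace, and is annihilated by
\<open>A - z\<close>.\<close>

lemma eigenvector_in_invariant_subspace:
  fixes A :: "complex^'p^'p"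
  assumes zero: "0 \<in> V"
    and add: "\<And>x y. x \<in> V \<Longrightarrow> y \<in> V \<Longrightarrow> x + y \<in> V"
    and smult: "\<And>c x. x \<in> V \<Longrightarrow> c *s x \<in> V"
    and inv: "\<And>x. x \<in> V \<Longrightarrow> A *v x \<in> V"
    and v: "v \<in> V" "v \<noteq> 0"
  obtains w z where "w \<in> V" "w \<noteq> 0" "A *v w = z *s w"
proof -
  define a where "a i = (((*v) A) ^^ i) v" for i
  have a_Suc: "A *v a i = a (Suc i)" for i by (simp add: a_def)
  have a_V: "a i \<in> V" for i by (induction i) (simp_all add: a_def v inv)
  define S where "S q = (\<Sum>i\<le>degree q. coeff q i *s a i)" for q :: "complex poly"
  have S_eq: "S q = (\<Sum>i\<le>n. coeff q i *s a i)" if "degree q \<le> n" for q n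
    unfolding S_def by (rule sum.mono_neutral_left) (use that in \<open>auto simp: coeff_eq_0\<close>)
  have S_V: "S q \<in> V" for q
  proof -
    have "finite I \<Longrightarrow> (\<Sum>i\<in>I. coeff q i *s a i) \<in> V" for I
      by (induction I rule: finite_induct) (auto intro: zero add smult a_V)
    then show ?thesis by (simp add: S_def)
  qed
  have "\<exists>q. q \<noteq> 0 \<and> S q = 0"
  proof -
    obtain c :: "nat \<Rightarrow> real" and n i where c: "i \<le> n" "c i \<noteq> 0" "(\<Sum>i\<le>n. c i *\<^sub>R a i) = 0"
      using finite_sequence_dependent[of a] .
    define q where "q = (\<Sum>j\<le>n. monom (complex_of_real (c j)) j)"
    have q: "coeff q j = (if j \<le> n then complex_of_real (c j) else 0)" for j
      by (auto simp: q_def coeff_sum coeff_monom sum.delta)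
    have "degree q \<le> n" by (rule degree_le) (simp add: q)
    from S_eq[OF this] have "S q = (\<Sum>i\<le>n. c i *\<^sub>R a i)"
      by (simp add: q scaleR_eq_smult)
    moreover have "q \<noteq> 0" using q[of i] c by auto
    ultimately show ?thesis using c(3) by auto
  qed
  then obtain q where q: "q \<noteq> 0" "S q = 0" and min: "\<And>r. r \<noteq> 0 \<Longrightarrow> S r = 0 \<Longrightarrow> degree q \<le> degree r"
    using ex_has_least_nat[of "\<lambda>q. q \<noteq> 0 \<and> S q = 0" _ degree] by metis
  have "degree q \<noteq> 0"
  proof
    assume "degree q = 0"
    then obtain c where "q = [:c:]" using degree_eq_zeroE by blast
    then show False using q v by (simp add: S_def a_def vec_eq_iff)
  qed
  then obtain z where "poly q z = 0"
    using fundamental_theorem_of_algebra[of q] constant_degree[of q] by auto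
  then obtain r where r: "q = [:- z, 1:] * r" using poly_eq_0_iff_dvd by (metis dvdE)
  then have "r \<noteq> 0" using q by auto
  then have deg: "degree q = Suc (degree r)" using r degree_mult_eq[of "[:- z, 1:]" r] by simp
  then have "S r \<noteq> 0" using min[OF \<open>r \<noteq> 0\<close>] by auto
  have "S q = (\<Sum>i\<le>Suc (degree r). (coeff (pCons 0 r) i - z * coeff r i) *s a i)"
    unfolding S_eq[OF eq_refl[OF deg]] by (simp add: r)
  also have "\<dots> = (\<Sum>i\<le>Suc (degree r). coeff (pCons 0 r) i *s a i) - z *s (\<Sum>i\<le>Suc (degree r). coeff r i *s a i)"
    by (simp only: vec.scale_left_diff_distrib sum_subtractf vec.scale_sum_right vec.scale_scale)
  also have "(\<Sum>i\<le>Suc (degree r). coeff (pCons 0 r) i *s a i) = A *v S r"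
    by (simp add: S_def sum.atMost_Suc_shift vec.linear_sum[OF matrix_vector_mul_linear_gen]
        vec.linear_scale[OF matrix_vector_mul_linear_gen] a_Suc del: sum.atMost_Suc)
  also have "(\<Sum>i\<le>Suc (degree r). coeff r i *s a i) = S r"
    by (rule S_eq[symmetric]) simp
  finally have "A *v S r = z *s S r" using q(2) by simp
  then show ?thesis using that S_V \<open>S r \<noteq> 0\<close> by blast
qed

abbreviation complexify :: "real^'p^'q \<Rightarrow> complex^'p^'q" where
  "complexify \<equiv> map_matrix complex_of_real"

lemma complexify_mult: "complexify (A ** B) = complexify A ** complexify B"
  by (simp add: vec_eq_iff matrix_matrix_mult_def)

lemma complexify_mat_1: "complexify (mat 1) = mat 1"
  by (simp add: vec_eq_iff mat_def)

lemma bounded_linear_complexify_mult: "bounded_linear (\<lambda>A :: real^'p^'p. complexify A *v w)"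
  unfolding linear_conv_bounded_linear[symmetric]
  by (rule linearI)
     (simp_all add: vec_eq_iff matrix_vector_mult_def sum.distrib algebra_simps sum_distrib_left
        scaleR_eq_smult)

lemmas complexify_mult_add = linear_add[OF bounded_linear.linear[OF bounded_linear_complexify_mult]]
  and complexify_mult_diff = linear_diff[OF bounded_linear.linear[OF bounded_linear_complexify_mult]]
  and complexify_mult_scaleR = linear_scale[OF bounded_linear.linear[OF bounded_linear_complexify_mult]]

text \<open>An eigenspace of \<open>B\<close> is invariant under every matrix that commutes with \<open>B\<close>.\<close>

lemma commuting_common_eigenvector:
  fixes A B :: "real^'p^'p"
  assumes AB: "A ** B = B ** A" and v: "complexify B *v v = \<mu> *s v" "v \<noteq> 0"
  obtains w z where "w \<noteq> 0" "complexify B *v w = \<mu> *s w" "complexify A *v w = z *s w"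
proof -
  let ?V = "{x. complexify B *v x = \<mu> *s x}"
  have inv: "complexify A *v x \<in> ?V" if "x \<in> ?V" for x
  proof -
    have "complexify B *v (complexify A *v x) = complexify A *v (complexify B *v x)"
      by (simp add: matrix_vector_mul_assoc AB flip: complexify_mult)
    then show ?thesis using that by (simp add: vec.scale)
  qed
  show ?thesis
    by (rule eigenvector_in_invariant_subspace[of ?V "complexify A" v])
       (use inv v that in \<open>auto simp: vec.add vec.scale vec.scale_right_distrib mult.commute\<close>)
qed

text \<open>The partial sums of the exponential series act on an eigenvector as the partial sums of the scalar
series.\<close>

lemma exp_m_eigenvector:
  fixes X :: "real^'p^'p"
  assumes "complexify X *v w = z *s w" shows "complexify (exp_m X) *v w = exp z *s w"
proof -
  have pw: "complexify (matrix_power X k) *v w = z ^ k *s w" for k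
    by (induction k)
       (simp_all add: matrix_power_0 matrix_power_Suc complexify_mult complexify_mat_1 assms vec.scale mult.commute
          flip: matrix_vector_mul_assoc)
  have bl: "bounded_linear (\<lambda>c :: complex. c *s w)"
    unfolding linear_conv_bounded_linear[symmetric]
    by (rule linearI) (simp_all add: vec_eq_iff algebra_simps)
  have "complexify (exp_m X) *v w = (\<Sum>k. (1 / fact k) *\<^sub>R (z ^ k *s w))"
    using exp_m_bounded_linear[OF bounded_linear_complexify_mult[of w], of X]
    by (simp only: complexify_mult_scaleR pw)
  also have "\<dots> = (\<Sum>k. (z ^ k /\<^sub>R fact k) *s w)"
    by (intro suminf_cong) (simp add: vec_eq_iff inverse_eq_divide)
  also have "\<dots> = exp z *s w"
    unfolding exp_def by (rule bounded_linear.suminf[OF bl summable_exp_generic, symmetric])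
  finally show ?thesis .
qed

lemma eigenvector_affine:
  assumes "complexify M *v w = \<mu> *s w"
  shows "complexify (mat 1 + t *\<^sub>R (M - mat 1)) *v w = (1 + complex_of_real t * (\<mu> - 1)) *s w"
proof -
  have "complexify (mat 1 + t *\<^sub>R (M - mat 1)) *v w = w + t *\<^sub>R (\<mu> *s w - w)"
    by (simp add: complexify_mult_add complexify_mult_diff complexify_mult_scaleR complexify_mat_1 assms)
  also have "\<dots> = (1 + complex_of_real t * (\<mu> - 1)) *s w"
    by (simp add: vec_eq_iff scaleR_eq_smult algebra_simps)
  finally show ?thesis .
qed

text \<open>An eigenvalue \<open>r \<le> 0\<close> would make the point of the segment with parameter \<open>1 / (1 - r)\<close> singular.\<close>

lemma log_domain_eigenvalue:
  fixes M :: "real^'p^'p"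
  assumes M: "M \<in> log_domain" and w: "complexify M *v w = \<mu> *s w" "w \<noteq> 0"
  shows "\<mu> \<notin> \<real>\<^sub>\<le>\<^sub>0"
proof
  assume "\<mu> \<in> \<real>\<^sub>\<le>\<^sub>0"
  then obtain r where r: "\<mu> = complex_of_real r" "r \<le> 0" by (auto elim: nonpos_Reals_cases)
  \<comment> \<open>The parameter at which \<open>1 + t (r - 1)\<close> vanishes.\<close>
  define t where "t = 1 / (1 - r)"
  have t: "t \<in> {0..1}" using r by (simp add: t_def)
  let ?N = "mat 1 + t *\<^sub>R (M - mat 1)"
  have "1 + complex_of_real t * (\<mu> - 1) = complex_of_real (1 + t * (r - 1))" by (simp add: r)
  also have "1 + t * (r - 1) = 0" using r by (simp add: t_def field_simps)
  finally have "complexify ?N *v w = 0" using eigenvector_affine[OF w(1), of t] by simp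
  then have "complexify (matrix_inv ?N ** ?N) *v w = 0"
    by (simp add: complexify_mult flip: matrix_vector_mul_assoc)
  moreover have "det ?N \<noteq> 0" using M t by (auto simp: log_domain_def)
  ultimately show False using w(2) by (simp add: matrix_inv_mult complexify_mat_1)
qed

lemma log_domain_eigenvalue_affine:
  fixes M :: "real^'p^'p"
  assumes M: "M \<in> log_domain" and w: "complexify M *v w = \<mu> *s w" "w \<noteq> 0" and t: "t \<in> {0..1}"
  shows "1 + complex_of_real t * (\<mu> - 1) \<notin> \<real>\<^sub>\<le>\<^sub>0"
proof (rule log_domain_eigenvalue[OF _ eigenvector_affine[OF w(1)] w(2)])
  show "mat 1 + t *\<^sub>R (M - mat 1) \<in> log_domain"
    using M t by (auto simp: log_domain_def mult_le_one)
qed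

lemma singular_kernel:
  fixes A :: "real^'n^'n"
  assumes "det A = 0" obtains x where "x \<noteq> 0" "A *v x = 0"
  using assms by (metis invertible_det_nz invertible_left_inverse matrix_left_invertible_ker)

lemma not_in_log_domain_eigenvector:
  fixes M :: "real^'p^'p"
  assumes "M \<notin> log_domain"
  obtains r w where "r \<le> 0" "w \<noteq> 0" "complexify M *v w = complex_of_real r *s w"
proof -
  obtain t where t: "t \<in> {0..1}" and d: "det (mat 1 + t *\<^sub>R (M - mat 1)) = 0"
    using assms by (auto simp: log_domain_def)
  obtain u where u: "u \<noteq> 0" "(mat 1 + t *\<^sub>R (M - mat 1)) *v u = 0"
    by (rule singular_kernel[OF d])
  have "t \<noteq> 0" using d by auto
  have "u + t *\<^sub>R (M *v u - u) = 0"
    using u(2) by (simp add: matrix_vector_mult_add_rdistrib matrix_vector_mult_diff_rdistrib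
        flip: scaleR_matrix_vector_assoc)
  then have "t *\<^sub>R (M *v u) = (t - 1) *\<^sub>R u" by (simp add: algebra_simps)
  then have "inverse t *\<^sub>R t *\<^sub>R (M *v u) = inverse t *\<^sub>R (t - 1) *\<^sub>R u" by simp
  then have Mu: "M *v u = ((t - 1) / t) *\<^sub>R u" using \<open>t \<noteq> 0\<close> by (simp add: divide_inverse mult.commute)
  define w where "w = (\<chi> i. complex_of_real (u $ i))"
  have "complexify M *v w = (\<chi> i. complex_of_real ((M *v u) $ i))"
    by (simp add: w_def vec_eq_iff matrix_vector_mult_def)
  also have "\<dots> = complex_of_real ((t - 1) / t) *s w"
    unfolding Mu by (simp add: w_def vec_eq_iff)
  finally have "complexify M *v w = complex_of_real ((t - 1) / t) *s w" .
  moreover have "w \<noteq> 0" using u(1) by (simp add: w_def vec_eq_iff)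
  moreover have "(t - 1) / t \<le> 0" using t by (simp add: divide_nonpos_nonneg)
  ultimately show ?thesis using that by blast
qed

lemma log_m_defined_iff: "log_m_defined M \<longleftrightarrow> M \<in> log_domain"
proof
  assume d: "log_m_defined M"
  show "M \<in> log_domain"
  proof (rule ccontr)
    assume "M \<notin> log_domain"
    then obtain r w where "r \<le> 0" "w \<noteq> 0" "complexify M *v w = complex_of_real r *s w"
      by (rule not_in_log_domain_eigenvector)
    then show False using d unfolding log_m_defined_def complex_eigenvalue_def by fastforce
  qed
next
  assume "M \<in> log_domain"
  then show "log_m_defined M"
    unfolding log_m_defined_def complex_eigenvalue_def using log_domain_eigenvalue by blast
qed

text \<open>If the curve \<open>exp (s X)\<close> leaves \<open>log_domain\<close>, then some \<open>exp (s X)\<close> has an eigenvalue \<open>r \<le> 0\<close>, and a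
common eigenvector with \<open>X\<close> shows \<open>r = exp (s z)\<close> for an eigenvalue \<open>z\<close> of \<open>X\<close>. That forces
\<open>\<bar>s Im z\<bar> \<ge> pi\<close>.\<close>

lemma strip_imp_exp_domain:
  fixes X :: "real^'p^'p"
  assumes strip: "\<And>z. complex_eigenvalue X z \<Longrightarrow> - pi < Im z \<and> Im z < pi"
  shows "X \<in> exp_domain"
proof (rule ccontr)
  assume "X \<notin> exp_domain"
  then obtain s where s: "s \<in> {0..1}" and "exp_m (s *\<^sub>R X) \<notin> log_domain"
    by (auto simp: exp_domain_def)
  then obtain r v where r: "r \<le> 0" and v: "v \<noteq> 0" "complexify (exp_m (s *\<^sub>R X)) *v v = complex_of_real r *s v"
    using not_in_log_domain_eigenvector by blast
  have "X ** exp_m (s *\<^sub>R X) = exp_m (s *\<^sub>R X) ** X"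
    by (rule exp_m_commute[symmetric]) (simp add: matrix_mult_scaleR_left matrix_mult_scaleR_right)
  from commuting_common_eigenvector[OF this v(2,1)] obtain w z where w: "w \<noteq> 0"
    "complexify (exp_m (s *\<^sub>R X)) *v w = complex_of_real r *s w" "complexify X *v w = z *s w" .
  have "complexify (s *\<^sub>R X) *v w = (complex_of_real s * z) *s w"
    by (simp add: complexify_mult_scaleR w(3) scaleR_eq_smult)
  from exp_m_eigenvector[OF this] w(1,2) have e: "exp (complex_of_real s * z) = complex_of_real r"
    by (metis vec.scale_right_imp_eq)
  have "\<bar>Im z\<bar> < pi" using strip[of z] w(1,3) unfolding complex_eigenvalue_def by fastforce
  then have "\<bar>s * Im z\<bar> < pi"
    using s mult_left_le_one_le[of "\<bar>Im z\<bar>" "\<bar>s\<bar>"] by (auto simp: abs_mult)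
  moreover have "sin (s * Im z) = 0" "cos (s * Im z) \<le> 0"
    using arg_cong[OF e, of Im] arg_cong[OF e, of Re] r
    by (simp_all add: Im_exp Re_exp) (metis exp_gt_zero mult_le_0_iff not_less)
  ultimately have "s * Im z = 0" "cos (s * Im z) \<le> 0" using sin_eq_0_pi[of "s * Im z"] by auto
  then show False by (simp only: cos_zero)
qed

text \<open>On a common eigenvector of \<open>M\<close> and its logarithm the matrix integral reduces to a scalar one with
value \<open>Ln \<mu>\<close>, the principal logarithm of an eigenvalue \<open>\<mu>\<close> off the closed negative axis.\<close>

lemma log_int_eigenvalue_strip:
  fixes M :: "real^'p^'p"
  assumes M: "M \<in> log_domain" and ev: "complex_eigenvalue (log_int M) z"
  shows "- pi < Im z \<and> Im z < pi"
proof -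
  obtain v where v: "v \<noteq> 0" "complexify (log_int M) *v v = z *s v"
    using ev unfolding complex_eigenvalue_def by blast
  from commuting_common_eigenvector[OF log_int_commute[OF M refl, symmetric] v(2,1)]
  obtain w \<mu> where w: "w \<noteq> 0" "complexify (log_int M) *v w = z *s w" "complexify M *v w = \<mu> *s w" .
  define c where "c t = 1 + complex_of_real t * (\<mu> - 1)" for t
  have c: "c t \<notin> \<real>\<^sub>\<le>\<^sub>0" if "t \<in> {0..1}" for t
    unfolding c_def by (rule log_domain_eigenvalue_affine[OF M w(3,1) that])
  have "((\<lambda>t. (\<mu> - 1) * inverse (c t)) has_integral (Ln (c 1) - Ln (c 0))) {0..1}"
  proof (rule fundamental_theorem_of_calculus[OF zero_le_one])
    fix t :: real assume t: "t \<in> {0..1}"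
    have "(c has_vector_derivative (\<mu> - 1)) (at t within {0..1})"
      unfolding c_def by (auto intro!: derivative_eq_intros)
    from field_vector_diff_chain_within[OF this has_field_derivative_at_within[OF has_field_derivative_Ln[OF c[OF t]]]]
    show "((\<lambda>t. Ln (c t)) has_vector_derivative (\<mu> - 1) * inverse (c t)) (at t within {0..1})"
      by (simp add: o_def)
  qed
  moreover have "Ln (c 1) - Ln (c 0) = Ln \<mu>" by (simp add: c_def)
  ultimately have I: "((\<lambda>t. (\<mu> - 1) * inverse (c t)) has_integral Ln \<mu>) {0..1}" by simp
  have bl: "bounded_linear (\<lambda>c :: complex. c *s w)"
    unfolding linear_conv_bounded_linear[symmetric]
    by (rule linearI) (simp_all add: vec_eq_iff algebra_simps)
  have "complexify (log_kernel M t) *v w = ((\<mu> - 1) * inverse (c t)) *s w" if t: "t \<in> {0..1}" for t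
  proof -
    let ?N = "mat 1 + t *\<^sub>R (M - mat 1)"
    have d: "det ?N \<noteq> 0" using M t by (auto simp: log_domain_def)
    have "c t \<noteq> 0" using c[OF t] by auto
    then have "w = complexify ?N *v (inverse (c t) *s w)"
      by (simp add: vec.scale eigenvector_affine[OF w(3)] flip: c_def)
    then have "complexify (matrix_inv ?N) *v w = complexify (matrix_inv ?N ** ?N) *v (inverse (c t) *s w)"
      by (simp add: complexify_mult flip: matrix_vector_mul_assoc)
    also have "\<dots> = inverse (c t) *s w" by (simp add: matrix_inv_mult[OF d] complexify_mat_1)
    finally have "complexify (log_kernel M t) *v w = inverse (c t) *s (complexify (M - mat 1) *v w)"
      by (simp add: log_kernel_def complexify_mult vec.scale flip: matrix_vector_mul_assoc)
    also have "complexify (M - mat 1) *v w = (\<mu> - 1) *s w"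
      by (simp add: complexify_mult_diff complexify_mat_1 w(3) vec_eq_iff algebra_simps)
    finally show ?thesis by (simp only: vec.scale_scale mult.commute[of "\<mu> - 1"])
  qed
  then have "integral {0..1} (\<lambda>t. complexify (log_kernel M t) *v w)
      = integral {0..1} (\<lambda>t. ((\<mu> - 1) * inverse (c t)) *s w)"
    by (rule integral_cong)
  also have "\<dots> = Ln \<mu> *s w"
    using has_integral_linear[OF I bl] by (simp add: o_def integral_unique)
  also have "integral {0..1} (\<lambda>t. complexify (log_kernel M t) *v w) = complexify (log_int M) *v w"
    using integral_linear[OF integrable_continuous_interval[OF continuous_on_log_kernel[OF M]]
        bounded_linear_complexify_mult]
    by (simp add: log_int_def o_def)
  finally have "z = Ln \<mu>" using w(1,2) by (metis vec.scale_right_imp_eq)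
  moreover have "\<mu> \<notin> \<real>\<^sub>\<le>\<^sub>0" using c[of 1] by (simp add: c_def)
  moreover from this have "\<mu> \<noteq> 0" by auto
  ultimately show ?thesis using mpi_less_Im_Ln[of \<mu>] Im_Ln_less_pi[of \<mu>] by auto
qed

text \<open>Existence is the strip property of the integral; for uniqueness, any \<open>X\<close> with spectrum in the strip
lies in \<open>exp_domain\<close> and is therefore the integral logarithm of its exponential.\<close>

lemma log_m_eq_log_int:
  fixes M :: "real^'p^'p"
  assumes M: "M \<in> log_domain" shows "log_m M = log_int M"
  unfolding log_m_def
proof (rule the_equality)
  show "exp_m (log_int M) = M \<and> (\<forall>z. complex_eigenvalue (log_int M) z \<longrightarrow> - pi < Im z \<and> Im z < pi)"
    using exp_m_log_int[OF M] log_int_eigenvalue_strip[OF M] by blast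
next
  fix X assume X: "exp_m X = M \<and> (\<forall>z. complex_eigenvalue X z \<longrightarrow> - pi < Im z \<and> Im z < pi)"
  then have "X \<in> exp_domain" by (intro strip_imp_exp_domain) blast
  then show "X = log_int M" using log_int_exp_m X by metis
qed

lemma log_int_in_exp_domain: "M \<in> log_domain \<Longrightarrow> log_int M \<in> exp_domain"
  by (intro strip_imp_exp_domain) (rule log_int_eigenvalue_strip)

section \<open>Positive definite square roots\<close>

lemma inner_transpose: "(x :: real^'m) \<bullet> (transpose A *v y) = (A *v x) \<bullet> y"
  by (metis dot_lmul_matrix inner_commute transpose_matrix_vector)

lemma gram_quadratic_form:
  "x \<bullet> (transpose A ** A *v x) = (A *v x) \<bullet> (A *v (x :: real^'p))"
  by (simp only: inner_transpose matrix_vector_mul_assoc[symmetric])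

lemma spdD:
  assumes "spd S" shows "transpose S = S" and "x \<noteq> 0 \<Longrightarrow> x \<bullet> (S *v x) > 0"
  using assms by (auto simp: spd_def)

text \<open>Positive definite matrices are invertible and form a convex set containing the identity.\<close>

lemma spd_in_log_domain:
  fixes S :: "real^'p^'p"
  assumes "spd S" shows "S \<in> log_domain"
  unfolding log_domain_def
proof (intro CollectI ballI notI)
  fix t :: real assume t: "t \<in> {0..1}" and "det (mat 1 + t *\<^sub>R (S - mat 1)) = 0"
  then obtain x where x: "x \<noteq> 0" "(mat 1 + t *\<^sub>R (S - mat 1)) *v x = 0"
    by (blast elim: singular_kernel)
  have "(1 - t) * (x \<bullet> x) + t * (x \<bullet> (S *v x)) = x \<bullet> ((mat 1 + t *\<^sub>R (S - mat 1)) *v x)"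
    by (simp add: matrix_vector_mult_add_rdistrib matrix_vector_mult_diff_rdistrib inner_add_right
        inner_diff_right algebra_simps flip: scaleR_matrix_vector_assoc)
  also have "\<dots> = 0" by (simp add: x)
  finally have 0: "(1 - t) * (x \<bullet> x) + t * (x \<bullet> (S *v x)) = 0" .
  have pos: "x \<bullet> x > 0" "x \<bullet> (S *v x) > 0" using x(1) spdD(2)[OF assms x(1)] by auto
  show False
  proof (cases "t = 0")
    case False
    then have "t * (x \<bullet> (S *v x)) > 0" "(1 - t) * (x \<bullet> x) \<ge> 0" using t pos by auto
    then show False using 0 by linarith
  qed (use 0 pos in auto)
qed

lemma log_domain_det_nonzero: "M \<in> log_domain \<Longrightarrow> det M \<noteq> 0"
  unfolding log_domain_def by (drule CollectD, drule bspec[where x = 1]) simp_all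

lemma spd_gram:
  fixes A :: "real^'p^'p"
  assumes "det A \<noteq> 0" shows "spd (transpose A ** A)"
  unfolding spd_def
proof (intro conjI allI impI)
  fix x :: "real^'p" assume "x \<noteq> 0"
  then have "A *v x \<noteq> 0"
    using assms by (metis invertible_det_nz invertible_left_inverse matrix_left_invertible_ker)
  then show "x \<bullet> (transpose A ** A *v x) > 0"
    by (simp add: gram_quadratic_form)
qed (simp add: matrix_transpose_mul)

lemma spd_mat_1_plus_gram: "spd (mat 1 + transpose B ** (B :: real^'p^'n))"
  unfolding spd_def
proof (intro conjI allI impI)
  fix x :: "real^'p" assume "x \<noteq> 0"
  then have "x \<bullet> x > 0" by simp
  moreover have "x \<bullet> (transpose B ** B *v x) \<ge> 0" by (simp add: gram_quadratic_form)
  ultimately show "x \<bullet> ((mat 1 + transpose B ** B) *v x) > 0"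
    by (simp only: matrix_vector_mult_add_rdistrib inner_add_right matrix_vector_mul_lid)
qed (simp add: matrix_transpose_mul transpose_add)

text \<open>The exponential of \<open>L\<close> is the Gram matrix of the invertible matrix \<open>exp (L / 2)\<close>.\<close>

lemma spd_exp_m:
  fixes L :: "real^'p^'p"
  assumes "transpose L = L" shows "spd (exp_m L)"
proof -
  let ?R = "exp_m ((1/2) *\<^sub>R L)"
  have R: "transpose ?R ** ?R = exp_m L"
    by (simp add: transpose_exp_m transpose_scalar assms exp_m_scaleR_mult)
  have "det ?R \<noteq> 0"
    using exp_m_inverse(2)[of "(1/2) *\<^sub>R L"] invertible_right_inverse invertible_det_nz by blast
  from spd_gram[OF this] show ?thesis by (simp only: R)
qed

lemma trace_quadratic_form:
  "trace (transpose D ** (R ** D)) = (\<Sum>j\<in>UNIV. column j D \<bullet> (R *v column j (D :: real^'p^'p)))"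
  by (simp add: trace_def inner_vec_def matrix_matrix_mult_def transpose_def column_def matrix_vector_mult_def)

text \<open>For \<open>D = R - Q\<close> the hypothesis reads \<open>R D + D Q = 0\<close>. Multiplying by \<open>D\<close> and taking the trace gives a
vanishing sum of the values of the positive definite forms \<open>R\<close> and \<open>Q\<close> at the columns of \<open>D\<close>.\<close>

lemma spd_square_inj:
  fixes R Q :: "real^'p^'p"
  assumes R: "spd R" and Q: "spd Q" and eq: "R ** R = Q ** Q"
  shows "R = Q"
proof -
  define D where "D = R - Q"
  have tD: "transpose D = D" using R Q by (simp add: D_def transpose_diff spd_def)
  have "R ** D + D ** Q = 0"
    by (simp add: D_def matrix_mult_diff_left matrix_mult_diff_right eq)
  then have "trace (D ** (R ** D + D ** Q)) = 0" by (simp add: matrix_mult_zero_right trace_def)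
  also have "D ** (R ** D + D ** Q) = D ** (R ** D) + D ** (D ** Q)"
    by (rule matrix_mult_add_right)
  also have "trace \<dots> = trace (D ** (R ** D)) + trace (D ** (Q ** D))"
    by (simp only: trace_add trace_mul_sym[of D "D ** Q"] matrix_mul_assoc[symmetric])
  finally have "(\<Sum>j\<in>UNIV. column j D \<bullet> (R *v column j D) + column j D \<bullet> (Q *v column j D)) = 0"
    using trace_quadratic_form[of D R] trace_quadratic_form[of D Q] by (simp add: tD sum.distrib)
  moreover have ge: "x \<bullet> (R *v x) + x \<bullet> (Q *v x) \<ge> 0" for x
    using spdD(2)[OF R, of x] spdD(2)[OF Q, of x] by (cases "x = 0") auto
  ultimately have z: "column j D \<bullet> (R *v column j D) + column j D \<bullet> (Q *v column j D) = 0" for j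
    by (subst (asm) sum_nonneg_eq_0_iff) auto
  then have "column j D = 0" for j
    using z[of j] spdD(2)[OF R, of "column j D"] spdD(2)[OF Q, of "column j D"] by fastforce
  then have "D = 0" by (simp add: column_def vec_eq_iff)
  then show ?thesis by (simp add: D_def)
qed

lemma inv_sqrt_m_square:
  assumes "spd P" shows "inv_sqrt_m (P ** P) = matrix_inv P"
proof -
  have "sqrt_m (P ** P) = P"
    unfolding sqrt_m_def by (rule the_equality) (use assms spd_square_inj in blast)+
  then show ?thesis by (simp add: inv_sqrt_m_def)
qed

text \<open>Unlike \<^const>\<open>inv_sqrt_m\<close>, this expression is meaningful and smooth on an open set of matrices that
need not be symmetric.\<close>

definition inv_sqrt_log :: "real^'p^'p \<Rightarrow> real^'p^'p" where
  "inv_sqrt_log S = exp_m ((- 1/2) *\<^sub>R log_int S)"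

lemma transpose_log_int_spd: "spd S \<Longrightarrow> transpose (log_int S) = log_int S"
  using transpose_log_int[OF spd_in_log_domain, of S] spdD(1)[of S] by simp

lemma spd_inv_sqrt_log: "spd S \<Longrightarrow> spd (inv_sqrt_log S)"
  unfolding inv_sqrt_log_def by (rule spd_exp_m) (simp add: transpose_minus transpose_scalar transpose_log_int_spd)

lemma inv_sqrt_log_sandwich:
  assumes "spd S" shows "inv_sqrt_log S ** S ** inv_sqrt_log S = mat 1"
proof -
  have "S = exp_m (1 *\<^sub>R log_int S)" using exp_m_log_int[OF spd_in_log_domain[OF assms]] by simp
  then have "inv_sqrt_log S ** S ** inv_sqrt_log S
      = inv_sqrt_log S ** exp_m (1 *\<^sub>R log_int S) ** inv_sqrt_log S" by simp
  also have "\<dots> = mat 1"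
    unfolding inv_sqrt_log_def by (simp only: exp_m_scaleR_mult) simp
  finally show ?thesis .
qed

lemma inv_sqrt_m_eq: 
  assumes "spd S" shows "inv_sqrt_m S = inv_sqrt_log S"
proof -
  let ?R = "exp_m ((1/2) *\<^sub>R log_int S)"
  have "spd ?R" by (rule spd_exp_m) (simp add: transpose_scalar transpose_log_int_spd assms)
  then have "inv_sqrt_m (?R ** ?R) = matrix_inv ?R" by (rule inv_sqrt_m_square)
  moreover have "?R ** ?R = S"
    by (simp add: exp_m_scaleR_mult exp_m_log_int[OF spd_in_log_domain[OF assms]])
  moreover have "matrix_inv ?R = inv_sqrt_log S"
    by (rule matrix_inv_unique) (simp add: inv_sqrt_log_def exp_m_inverse)
  ultimately show ?thesis by simp
qed

lemma Ck_on_inv_sqrt_log: "Ck_on k log_domain (inv_sqrt_log :: real^'p^'p \<Rightarrow> _)"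
  unfolding inv_sqrt_log_def[abs_def]
  by (rule Ck_on_exp_m[OF Ck_on_linear_compose[OF bounded_linear_scaleR_right Ck_on_log_int open_log_domain] open_log_domain])

section \<open>Skew-symmetric and orthogonal matrices\<close>

lemma exp_m_skew_orthogonal:
  assumes "A \<in> skew" shows "transpose (exp_m A) ** exp_m A = mat 1"
  using assms exp_m_inverse(1)[of A] by (simp add: skew_def transpose_exp_m)

text \<open>For orthogonal \<open>M\<close> the transpose is the inverse, so \<open>A\<^sup>T\<close> and \<open>- A\<close>, with \<open>A\<close> the logarithm of \<open>M\<close>, have
the same exponential. Both are the integral logarithm of \<open>M\<^sup>T\<close>: the first because transposition passes
through the integral, the second because the strip is symmetric under \<open>z \<mapsto> - z\<close>.\<close>

lemma log_int_orthogonal_skew: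
  fixes M :: "real^'p^'p"
  assumes M: "M \<in> log_domain" and orth: "transpose M ** M = mat 1"
  shows "log_int M \<in> skew"
proof -
  let ?A = "log_int M"
  have "- ?A \<in> exp_domain"
  proof (rule strip_imp_exp_domain)
    fix z assume "complex_eigenvalue (- ?A) z"
    then obtain v where v: "v \<noteq> 0" "complexify (- ?A) *v v = z *s v"
      unfolding complex_eigenvalue_def by blast
    have "complexify (- ?A) *v v = - (complexify ?A *v v)"
      by (rule linear_neg[OF bounded_linear.linear[OF bounded_linear_complexify_mult]])
    then have "complexify ?A *v v = (- z) *s v" using v(2) by (metis minus_minus vec.scale_minus_left)
    then have "complex_eigenvalue ?A (- z)" using v(1) unfolding complex_eigenvalue_def by blast
    from log_int_eigenvalue_strip[OF M this] show "- pi < Im z \<and> Im z < pi" by auto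
  qed
  then have "log_int (exp_m (- ?A)) = - ?A" by (rule log_int_exp_m)
  moreover have "exp_m (- ?A) = transpose M"
  proof -
    have "M ** transpose M = mat 1" using orth matrix_left_right_inverse by blast
    moreover have "exp_m (- ?A) ** M = mat 1"
      using exp_m_inverse(1)[of ?A] by (simp add: exp_m_log_int[OF M])
    ultimately show ?thesis by (metis matrix_mul_assoc matrix_mul_lid matrix_mul_rid)
  qed
  ultimately show ?thesis using transpose_log_int[OF M] by (simp add: skew_def)
qed

section \<open>Block decomposition\<close>

lemma upper_stack: "inj \<iota> \<Longrightarrow> upper \<iota> (stack \<iota> A B) = A"
  by (simp add: upper_def stack_def vec_eq_iff)

lemma lower_stack: "B \<in> lower_blocks \<iota> \<Longrightarrow> lower \<iota> (stack \<iota> A B) = B"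
  by (auto simp: lower_def stack_def lower_blocks_def vec_eq_iff)

lemma stack_upper_lower: "stack \<iota> (upper \<iota> U) (lower \<iota> U) = U"
  by (auto simp: upper_def lower_def stack_def vec_eq_iff f_inv_into_f)

lemma stack_mult: "stack \<iota> A B ** P = stack \<iota> (A ** P) (B ** P)"
  by (auto simp: stack_def matrix_matrix_mult_def vec_eq_iff)

lemma lower_in_lower_blocks: "lower \<iota> U \<in> lower_blocks \<iota>"
  by (simp add: lower_def lower_blocks_def)

lemma lower_blocks_mult: "B \<in> lower_blocks \<iota> \<Longrightarrow> B ** P \<in> lower_blocks \<iota>"
  by (auto simp: lower_blocks_def matrix_matrix_mult_def vec_eq_iff)

text \<open>The rows indexed by the range of the injection contribute the Gram matrix of the upper block, all
others that of the lower block, which has zero rows in place of the former.\<close>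

lemma gram_blocks:
  fixes \<iota> :: "'p::finite \<Rightarrow> 'n::finite"
  assumes "inj \<iota>"
  shows "transpose U ** U = transpose (upper \<iota> U) ** upper \<iota> U + transpose (lower \<iota> U) ** lower \<iota> U"
proof -
  have "(\<Sum>k\<in>UNIV. U $ k $ i * U $ k $ j) = (\<Sum>k\<in>UNIV. U $ \<iota> k $ i * U $ \<iota> k $ j)
      + (\<Sum>k\<in>UNIV. lower \<iota> U $ k $ i * lower \<iota> U $ k $ j)" for i j
  proof -
    have "(\<Sum>k\<in>UNIV. U $ k $ i * U $ k $ j)
        = (\<Sum>k\<in>range \<iota>. U $ k $ i * U $ k $ j) + (\<Sum>k\<in>-range \<iota>. U $ k $ i * U $ k $ j)"
      using sum.subset_diff[of "range \<iota>" UNIV "\<lambda>k. U $ k $ i * U $ k $ j"]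
      by (simp add: Compl_eq_Diff_UNIV add.commute)
    also have "(\<Sum>k\<in>range \<iota>. U $ k $ i * U $ k $ j) = (\<Sum>k\<in>UNIV. U $ \<iota> k $ i * U $ \<iota> k $ j)"
      by (simp add: sum.reindex[OF assms])
    also have "(\<Sum>k\<in>-range \<iota>. U $ k $ i * U $ k $ j) = (\<Sum>k\<in>UNIV. lower \<iota> U $ k $ i * lower \<iota> U $ k $ j)"
      by (rule sum.mono_neutral_cong_left) (auto simp: lower_def)
    finally show ?thesis .
  qed
  then show ?thesis
    by (simp add: vec_eq_iff matrix_matrix_mult_def transpose_def upper_def)
qed

section \<open>The chart and its inverse\<close>

text \<open>The points of the ambient matrix space at which the formula for the chart makes sense; every chart
domain is contained in it.\<close>

definition max_chart_domain :: "('p::finite \<Rightarrow> 'n::finite) \<Rightarrow> (real^'p^'n) set" where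
  "max_chart_domain \<iota> = {U. invertible (upper \<iota> U) \<and> log_m_defined (polar_factor (upper \<iota> U))}"

text \<open>The chart \<^const>\<open>psi\<close> with its descriptively defined logarithm and square root replaced by integral and
exponential formulas, which can be differentiated in the ambient matrix space.\<close>

definition psi_log :: "('p::finite \<Rightarrow> 'n::finite) \<Rightarrow> real^'p^'n \<Rightarrow> (real^'p^'p) \<times> (real^'p^'n)" where
  "psi_log \<iota> U = (log_int (upper \<iota> U ** inv_sqrt_log (transpose (upper \<iota> U) ** upper \<iota> U)),
              lower \<iota> U ** inv_sqrt_log (transpose (upper \<iota> U) ** upper \<iota> U))"

text \<open>Written through the integral formulas, the conditions become preimages of an open set under
continuous maps.\<close>

lemma max_chart_domain_eq:
  fixes \<iota> :: "'p::finite \<Rightarrow> 'n::finite"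
  shows "max_chart_domain \<iota> = {U. transpose (upper \<iota> U) ** upper \<iota> U \<in> log_domain}
     \<inter> (\<lambda>U. upper \<iota> U ** inv_sqrt_log (transpose (upper \<iota> U) ** upper \<iota> U)) -` log_domain"
proof -
  have "transpose A ** A \<in> log_domain \<longleftrightarrow> invertible A" for A :: "real^'p^'p"
    using log_domain_det_nonzero[of "transpose A ** A"] spd_in_log_domain[OF spd_gram[of A]]
    by (auto simp: invertible_det_nz det_mul)
  moreover have "polar_factor A = A ** inv_sqrt_log (transpose A ** A)" if "invertible A" for A :: "real^'p^'p"
    using that by (simp add: polar_factor_def inv_sqrt_m_eq spd_gram invertible_det_nz)
  ultimately show ?thesis by (auto simp: max_chart_domain_def log_m_defined_iff)
qed

lemma psi_eq_psi_log:
  assumes "U \<in> max_chart_domain \<iota>" shows "psi \<iota> U = psi_log \<iota> U"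
proof -
  have "spd (transpose (upper \<iota> U) ** upper \<iota> U)" "log_m_defined (polar_factor (upper \<iota> U))"
    using assms by (auto simp: max_chart_domain_def invertible_det_nz spd_gram)
  then show ?thesis
    by (simp add: psi_def psi_log_def polar_factor_def inv_sqrt_m_eq log_m_eq_log_int log_m_defined_iff)
qed

lemma bounded_linear_upper: "bounded_linear (upper \<iota> :: real^'p^'n \<Rightarrow> real^'p^'p)"
  and bounded_linear_lower: "bounded_linear (lower \<iota> :: real^'p^'n \<Rightarrow> real^'p^'n)"
  and bounded_linear_stack: "bounded_linear (\<lambda>p :: (real^'p^'p) \<times> (real^'p^'n). stack \<iota> (fst p) (snd p))"
  unfolding linear_conv_bounded_linear[symmetric]
  by (auto intro!: linearI simp: upper_def lower_def stack_def vec_eq_iff)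

lemma open_max_chart_domain: "open (max_chart_domain \<iota>)"
  and Ck_on_psi_log: "Ck_on k (max_chart_domain \<iota>) (psi_log \<iota>)"
proof -
  let ?G = "\<lambda>U. transpose (upper \<iota> U) ** upper \<iota> U"
  let ?W = "{U. ?G U \<in> log_domain}"
  have up: "Ck_on k S (upper \<iota>)" and lo: "Ck_on k S (lower \<iota>)" if "open S" for S k
    by (rule Ck_on_bounded_linear bounded_linear_upper bounded_linear_lower that)+
  have G: "Ck_on k UNIV ?G" for k
    by (intro Ck_on_matrix_mult Ck_on_linear_compose[OF bounded_linear_transpose] up open_UNIV)
  have W: "open ?W"
    using continuous_on_open_vimage[OF open_UNIV, of ?G] Ck_on_imp_continuous_on[OF G[of 0]] open_log_domain
    by (force simp: vimage_def)
  have S: "Ck_on k ?W (\<lambda>U. inv_sqrt_log (?G U))" for k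
    by (rule Ck_on_compose[OF Ck_on_subset[OF G subset_UNIV] Ck_on_inv_sqrt_log W open_log_domain]) simp
  have polar: "Ck_on k ?W (\<lambda>U. upper \<iota> U ** inv_sqrt_log (?G U))" for k
    by (intro Ck_on_matrix_mult up S W)
  show R: "open (max_chart_domain \<iota>)"
    unfolding max_chart_domain_eq
    by (rule continuous_open_preimage[OF Ck_on_imp_continuous_on[OF polar[of 0]] W open_log_domain])
  have sub: "max_chart_domain \<iota> \<subseteq> ?W" unfolding max_chart_domain_eq by blast
  show "Ck_on k (max_chart_domain \<iota>) (psi_log \<iota>)"
    unfolding psi_log_def[abs_def]
  proof (intro Ck_on_Pair R)
    show "Ck_on k (max_chart_domain \<iota>) (\<lambda>U. log_int (upper \<iota> U ** inv_sqrt_log (?G U)))"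
      by (rule Ck_on_compose[OF Ck_on_subset[OF polar sub] Ck_on_log_int R open_log_domain])
         (auto simp: max_chart_domain_eq)
    show "Ck_on k (max_chart_domain \<iota>) (\<lambda>U. lower \<iota> U ** inv_sqrt_log (?G U))"
      by (intro Ck_on_matrix_mult lo R Ck_on_subset[OF S sub])
  qed
qed

lemma Ck_on_phi: "Ck_on k UNIV (phi (\<iota> :: 'p::finite \<Rightarrow> 'n::finite))"
proof -
  note id = Ck_on_bounded_linear[OF bounded_linear_fst open_UNIV] Ck_on_bounded_linear[OF bounded_linear_snd open_UNIV]
  have "Ck_on k UNIV (\<lambda>p :: (real^'p^'p) \<times> (real^'p^'n). stack \<iota> (fst (exp_m (fst p), snd p)) (snd (exp_m (fst p), snd p)))"
    by (rule Ck_on_linear_compose[OF bounded_linear_stack])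
       (intro Ck_on_Pair Ck_on_exp_m id open_UNIV)+
  moreover have "Ck_on k UNIV (\<lambda>p :: (real^'p^'p) \<times> (real^'p^'n). mat 1 + transpose (snd p) ** snd p)"
    by (intro Ck_on_add Ck_on_const Ck_on_matrix_mult Ck_on_linear_compose[OF bounded_linear_transpose] id open_UNIV)
  from Ck_on_compose[OF this Ck_on_inv_sqrt_log open_UNIV open_log_domain spd_in_log_domain[OF spd_mat_1_plus_gram]]
  have "Ck_on k UNIV (\<lambda>p :: (real^'p^'p) \<times> (real^'p^'n). inv_sqrt_log (mat 1 + transpose (snd p) ** snd p))" .
  ultimately have "Ck_on k UNIV (\<lambda>p :: (real^'p^'p) \<times> (real^'p^'n).
      stack \<iota> (fst (exp_m (fst p), snd p)) (snd (exp_m (fst p), snd p)) ** inv_sqrt_log (mat 1 + transpose (snd p) ** snd p))"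
    by (intro Ck_on_matrix_mult open_UNIV)
  then show ?thesis
    by (rule Ck_on_cong) (auto simp: phi_def inv_sqrt_m_eq spd_mat_1_plus_gram)
qed

text \<open>The stacked matrix has Gram matrix \<open>I + B\<^sup>T B\<close>, because \<open>exp A\<close> is orthogonal; the right factor
normalises it.\<close>

lemma phi_in_Stiefel:
  fixes \<iota> :: "'p::finite \<Rightarrow> 'n::finite"
  assumes "inj \<iota>" and A: "A \<in> skew" and B: "B \<in> lower_blocks \<iota>"
  shows "phi \<iota> (A, B) \<in> Stiefel"
proof -
  let ?S = "mat 1 + transpose B ** B" let ?P = "inv_sqrt_log ?S"
  let ?V = "stack \<iota> (exp_m A) B"
  have "transpose ?V ** ?V = ?S"
    using gram_blocks[OF assms(1), of ?V]
    by (simp add: upper_stack lower_stack assms exp_m_skew_orthogonal)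
  moreover have "transpose ?P = ?P" by (rule spdD(1)[OF spd_inv_sqrt_log[OF spd_mat_1_plus_gram]])
  moreover have "transpose (?V ** ?P) ** (?V ** ?P) = transpose ?P ** (transpose ?V ** ?V) ** ?P"
    by (simp only: matrix_transpose_mul matrix_mul_assoc)
  ultimately have "transpose (?V ** ?P) ** (?V ** ?P) = ?P ** ?S ** ?P" by simp
  then show ?thesis
    by (simp add: Stiefel_def phi_def inv_sqrt_m_eq spd_mat_1_plus_gram inv_sqrt_log_sandwich)
qed

text \<open>With \<open>S = U\<^sub>1\<^sup>T U\<^sub>1\<close> and \<open>P = S\<^bsup>-1/2\<^esup>\<close>, the relation \<open>U\<^sub>2\<^sup>T U\<^sub>2 = I - S\<close> on the Stiefel manifold gives
\<open>I + (U\<^sub>2 P)\<^sup>T (U\<^sub>2 P) = P\<^sup>2\<close>. The inverse square root in \<^const>\<open>phi\<close> is therefore \<open>P\<^bsup>-1\<^esup>\<close>, and it cancels the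
\<open>P\<close> introduced by \<^const>\<open>psi\<close>.\<close>

lemma phi_psi:
  fixes \<iota> :: "'p::finite \<Rightarrow> 'n::finite"
  assumes "inj \<iota>" and U: "U \<in> Stiefel" "U \<in> max_chart_domain \<iota>"
  shows "psi \<iota> U \<in> (skew \<inter> exp_domain) \<times> lower_blocks \<iota>" and "phi \<iota> (psi \<iota> U) = U"
proof -
  let ?U1 = "upper \<iota> U" and ?U2 = "lower \<iota> U"
  let ?S = "transpose ?U1 ** ?U1"
  define P where "P = inv_sqrt_log ?S"
  have spdS: "spd ?S" using U(2) by (auto simp: max_chart_domain_def invertible_det_nz spd_gram)
  have P: "spd P" "P ** ?S ** P = mat 1"
    unfolding P_def by (rule spd_inv_sqrt_log[OF spdS] inv_sqrt_log_sandwich[OF spdS])+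
  have detP: "det P \<noteq> 0" by (rule log_domain_det_nonzero[OF spd_in_log_domain[OF P(1)]])
  let ?Q = "?U1 ** P"
  have psi: "psi \<iota> U = (log_int ?Q, ?U2 ** P)"
    using psi_eq_psi_log[OF U(2)] by (simp add: psi_log_def P_def)
  have Q: "?Q \<in> log_domain" using U(2) by (simp add: max_chart_domain_eq P_def)
  have "transpose ?Q ** ?Q = P ** ?S ** P"
    by (simp add: matrix_transpose_mul spdD(1)[OF P(1)] matrix_mul_assoc)
  then have "transpose ?Q ** ?Q = mat 1" by (simp add: P(2))
  from log_int_orthogonal_skew[OF Q this] show "psi \<iota> U \<in> (skew \<inter> exp_domain) \<times> lower_blocks \<iota>"
    by (simp add: psi log_int_in_exp_domain[OF Q] lower_blocks_mult lower_in_lower_blocks)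
  have "transpose ?U2 ** ?U2 = mat 1 - ?S"
    using gram_blocks[OF assms(1), of U] U(1) by (simp add: Stiefel_def algebra_simps)
  moreover have "transpose (?U2 ** P) ** (?U2 ** P) = P ** (transpose ?U2 ** ?U2) ** P"
    by (simp add: matrix_transpose_mul spdD(1)[OF P(1)] matrix_mul_assoc)
  ultimately have "mat 1 + transpose (?U2 ** P) ** (?U2 ** P) = P ** P"
    by (simp add: matrix_mult_diff_left matrix_mult_diff_right P(2))
  then have "phi \<iota> (psi \<iota> U) = stack \<iota> (?U1 ** P) (?U2 ** P) ** matrix_inv P"
    by (simp add: psi phi_def exp_m_log_int[OF Q] inv_sqrt_m_square[OF P(1)])
  also have "\<dots> = U"
    by (simp add: stack_upper_lower matrix_inv_mult[OF detP] flip: stack_mult matrix_mul_assoc)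
  finally show "phi \<iota> (psi \<iota> U) = U" .
qed

text \<open>With \<open>P = (I + B\<^sup>T B)\<^bsup>-1/2\<^esup>\<close> the upper block \<open>exp A P\<close> has Gram matrix \<open>P\<^sup>2\<close>, so its polar factor is
\<open>exp A\<close>, from which \<open>A\<close> is recovered because it lies in \<open>exp_domain\<close>.\<close>

lemma psi_phi:
  fixes \<iota> :: "'p::finite \<Rightarrow> 'n::finite"
  assumes "inj \<iota>" and A: "A \<in> skew" "A \<in> exp_domain" and B: "B \<in> lower_blocks \<iota>"
  shows "phi \<iota> (A, B) \<in> max_chart_domain \<iota>" and "psi \<iota> (phi \<iota> (A, B)) = (A, B)"
proof -
  let ?S = "mat 1 + transpose B ** B"
  define P where "P = inv_sqrt_log ?S"
  let ?U = "phi \<iota> (A, B)"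
  have P: "spd P" unfolding P_def by (rule spd_inv_sqrt_log[OF spd_mat_1_plus_gram])
  have detP: "det P \<noteq> 0" by (rule log_domain_det_nonzero[OF spd_in_log_domain[OF P]])
  have phi: "?U = stack \<iota> (exp_m A ** P) (B ** P)"
    by (simp add: phi_def P_def inv_sqrt_m_eq spd_mat_1_plus_gram stack_mult)
  have up: "upper \<iota> ?U = exp_m A ** P" and lo: "lower \<iota> ?U = B ** P"
    by (simp_all add: phi upper_stack assms(1) lower_stack lower_blocks_mult B)
  have "transpose (upper \<iota> ?U) ** upper \<iota> ?U = P ** (transpose (exp_m A) ** exp_m A) ** P"
    by (simp add: up matrix_transpose_mul spdD(1)[OF P] matrix_mul_assoc)
  then have gram: "transpose (upper \<iota> ?U) ** upper \<iota> ?U = P ** P"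
    by (simp add: exp_m_skew_orthogonal[OF A(1)])
  have polar: "polar_factor (upper \<iota> ?U) = exp_m A"
    unfolding polar_factor_def gram
    unfolding inv_sqrt_m_square[OF P] up
    by (simp add: matrix_inv_mult[OF detP] flip: matrix_mul_assoc)
  have logd: "exp_m A \<in> log_domain" by (rule exp_m_in_log_domain[OF A(2)])
  have "det (upper \<iota> ?U) \<noteq> 0" using log_domain_det_nonzero[OF logd] detP by (simp add: up det_mul)
  then show "?U \<in> max_chart_domain \<iota>"
    by (simp add: max_chart_domain_def invertible_det_nz polar log_m_defined_iff logd)
  have "log_m (polar_factor (upper \<iota> ?U)) = A"
    by (simp add: polar log_m_eq_log_int[OF logd] log_int_exp_m[OF A(2)])
  moreover have "lower \<iota> ?U ** inv_sqrt_m (transpose (upper \<iota> ?U) ** upper \<iota> ?U) = B"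
    unfolding gram
    unfolding inv_sqrt_m_square[OF P] lo
    by (simp add: matrix_inv_mult[OF detP] flip: matrix_mul_assoc)
  ultimately show "psi \<iota> ?U = (A, B)" by (simp add: psi_def)
qed

lemma smooth_map_if_Ck_on:
  assumes "open W" "S \<subseteq> W" "\<And>k. Ck_on k W g" "\<And>x. x \<in> S \<Longrightarrow> g x = f x"
  shows "smooth_map S f"
  unfolding smooth_map_def using assms by (intro ballI exI[of _ W] exI[of _ g]) auto

text \<open>The reason why the largest chart domain, the image of this set under \<^const>\<open>phi\<close>, is path connected.\<close>

lemma starlike_coordinates: "starlike ((skew \<inter> exp_domain) \<times> lower_blocks (\<iota> :: 'p::finite \<Rightarrow> 'n::finite))"
  unfolding starlike_def
proof (intro bexI ballI subsetI)
  show "0 \<in> (skew \<inter> exp_domain) \<times> lower_blocks \<iota>"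
    by (simp add: zero_prod_def skew_def transpose_def vec_eq_iff exp_domain_def lower_blocks_def mat_1_in_log_domain)
next
  fix x y assume x: "x \<in> (skew \<inter> exp_domain) \<times> lower_blocks \<iota>" and "y \<in> closed_segment 0 x"
  then obtain u where "u \<in> {0..1}" "y = u *\<^sub>R x" by (auto simp: closed_segment_def)
  then show "y \<in> (skew \<inter> exp_domain) \<times> lower_blocks \<iota>"
    using x by (auto simp: scaleR_in_exp_domain skew_def transpose_scalar lower_blocks_def)
qed

theorem lemma3p2:
  fixes \<iota> :: "'p::finite \<Rightarrow> 'n::finite"
  assumes "inj \<iota>"
  shows "(\<exists>D. chart_domain \<iota> D) \<and>
    phi \<iota> ` (skew \<times> lower_blocks \<iota>) \<subseteq> Stiefel \<and>
    (\<forall>D. chart_domain \<iota> D \<longrightarrow>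
      openin (top_of_set (skew \<times> lower_blocks \<iota>)) (psi \<iota> ` D) \<and>
      diffeomorphism D (psi \<iota> ` D) (psi \<iota>) (phi \<iota>))"
proof (intro conjI allI impI)
  let ?C = "(skew \<inter> exp_domain) \<times> lower_blocks \<iota>"
  note phi_psi = phi_psi[OF assms] and psi_phi = psi_phi[OF assms]
  note phi_cont = Ck_on_imp_continuous_on[OF Ck_on_phi[of 0 \<iota>]]
  have C_image: "phi \<iota> ` ?C = Stiefel \<inter> max_chart_domain \<iota>"
  proof
    show "phi \<iota> ` ?C \<subseteq> Stiefel \<inter> max_chart_domain \<iota>"
      using psi_phi(1) phi_in_Stiefel[OF assms] by auto
    show "Stiefel \<inter> max_chart_domain \<iota> \<subseteq> phi \<iota> ` ?C"
    proof
      fix U assume "U \<in> Stiefel \<inter> max_chart_domain \<iota>"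
      then have U: "U \<in> Stiefel" "U \<in> max_chart_domain \<iota>" by auto
      show "U \<in> phi \<iota> ` ?C" by (rule image_eqI[where f = "phi \<iota>", OF phi_psi(2)[OF U, symmetric] phi_psi(1)[OF U]])
    qed
  qed
  have "chart_domain \<iota> (Stiefel \<inter> max_chart_domain \<iota>)"
    unfolding chart_domain_def
  proof (intro conjI ballI)
    show "openin (top_of_set Stiefel) (Stiefel \<inter> max_chart_domain \<iota>)"
      by (rule openin_open_Int[OF open_max_chart_domain])
    show "path_connected (Stiefel \<inter> max_chart_domain \<iota>)"
      unfolding C_image[symmetric]
      by (rule path_connected_continuous_image[OF continuous_on_subset[OF phi_cont subset_UNIV]
            starlike_imp_path_connected[OF starlike_coordinates]])
    have one: "inv_sqrt_m (mat 1 :: real^'p^'p) = mat 1"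
      using inv_sqrt_m_square[of "mat 1 :: real^'p^'p"] spd_exp_m[of 0] matrix_inv_unique[of "mat 1 :: real^'p^'p" "mat 1"]
      by (simp add: transpose_def vec_eq_iff)
    have "base_point \<iota> = phi \<iota> (0, 0)"
      by (simp add: phi_def base_point_def one matrix_mult_zero_right)
    also have "(0, 0) \<in> ?C"
      by (simp add: skew_def transpose_def vec_eq_iff exp_domain_def lower_blocks_def mat_1_in_log_domain)
    then have "phi \<iota> (0, 0) \<in> Stiefel \<inter> max_chart_domain \<iota>" unfolding C_image[symmetric] by (rule imageI)
    finally show "base_point \<iota> \<in> Stiefel \<inter> max_chart_domain \<iota>" .
  qed (auto simp: max_chart_domain_def)
  then show "\<exists>D. chart_domain \<iota> D" by blast
  show "phi \<iota> ` (skew \<times> lower_blocks \<iota>) \<subseteq> Stiefel"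
    using phi_in_Stiefel[OF assms] by auto
  fix D assume D: "chart_domain \<iota> D"
  then have DR: "D \<subseteq> max_chart_domain \<iota>" by (auto simp: chart_domain_def max_chart_domain_def)
  obtain W where W: "open W" "D = Stiefel \<inter> W"
    using D by (auto simp: chart_domain_def openin_open)
  \<comment> \<open>Openness of the image: it is cut out of the coordinate space by two open conditions.\<close>
  have image: "psi \<iota> ` D = ?C \<inter> phi \<iota> -` W"
  proof
    show "psi \<iota> ` D \<subseteq> ?C \<inter> phi \<iota> -` W"
    proof
      fix y assume "y \<in> psi \<iota> ` D"
      then obtain U where U: "U \<in> D" "y = psi \<iota> U" by blast
      then have "U \<in> Stiefel" "U \<in> max_chart_domain \<iota>" "U \<in> W" using W DR by auto
      then show "y \<in> ?C \<inter> phi \<iota> -` W" using phi_psi[of U] U(2) by auto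
    qed
    show "?C \<inter> phi \<iota> -` W \<subseteq> psi \<iota> ` D"
    proof clarify
      fix A B assume AB: "A \<in> skew" "A \<in> exp_domain" "B \<in> lower_blocks \<iota>" "phi \<iota> (A, B) \<in> W"
      then have "phi \<iota> (A, B) \<in> D" using W phi_in_Stiefel[OF assms] by auto
      then show "(A, B) \<in> psi \<iota> ` D" by (rule image_eqI[where f = "psi \<iota>", OF psi_phi(2)[OF AB(1-3), symmetric]])
    qed
  qed
  have "open ((exp_domain \<times> UNIV) \<inter> phi \<iota> -` W)"
    using phi_cont continuous_on_open_vimage[OF open_UNIV, of "phi \<iota>"] W(1)
    by (intro open_Int open_Times open_exp_domain open_UNIV) auto
  then show "openin (top_of_set (skew \<times> lower_blocks \<iota>)) (psi \<iota> ` D)"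
    unfolding openin_open image by (intro exI[of _ "(exp_domain \<times> UNIV) \<inter> phi \<iota> -` W"]) auto
  have smooth_psi: "smooth_map D (psi \<iota>)"
    by (rule smooth_map_if_Ck_on[OF open_max_chart_domain DR Ck_on_psi_log]) (use psi_eq_psi_log DR in fastforce)
  have smooth_phi: "smooth_map (psi \<iota> ` D) (phi \<iota>)"
    by (rule smooth_map_if_Ck_on[OF open_UNIV subset_UNIV Ck_on_phi refl])
  have cont_psi: "continuous_on D (psi \<iota>)"
    by (rule continuous_on_eq[OF continuous_on_subset[OF Ck_on_imp_continuous_on[OF Ck_on_psi_log[of 0]] DR]])
       (use psi_eq_psi_log DR in fastforce)
  have inv: "phi \<iota> (psi \<iota> U) = U" if "U \<in> D" for U
    using phi_psi(2)[of U] that W DR by blast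
  have "homeomorphism D (psi \<iota> ` D) (psi \<iota>) (phi \<iota>)"
    by (rule homeomorphismI[OF cont_psi continuous_on_subset[OF phi_cont subset_UNIV]]) (auto simp: inv)
  then show "diffeomorphism D (psi \<iota> ` D) (psi \<iota>) (phi \<iota>)"
    using smooth_psi smooth_phi by (simp add: diffeomorphism_def)
qed

end
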